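(* Let $G$ be a finite abstract simplicial complex, $k\ge1$, and $T$ an automorphism of $G$. Then $$\chi_T(G)=\sum_{(x_1,\dots,x_k):\,T(x_j)=x_j\ \forall j} i_T(x_1,\dots,x_k),$$ where the sum runs over all interacting $k$-tuples of simplices of $G$ fixed by $T$, and $i_T(x_1,\dots,x_k)=\prod_{j=1}^k(-1)^{\dim(x_j)}\,\mathrm{sign}(T|x_j)$.
   Context: A finite abstract simplicial complex $G$ is a finite set of nonempty finite sets closed under taking nonempty subsets; $\dim(x)=|x|-1$. Fix an orientation of every simplex. For an oriented simplex $x=(v_0,\dots,v_m)$, $m\ge1$, $\delta x=\sum_{i=0}^m(-1)^i(v_0,\dots,\hat v_i,\dots,v_m)$ (faces with opposite orientation counted with sign $-1$), and $\delta x=0$ for $m=0$. An interacting $k$-tuple is $(x_1,\dots,x_k)$ with $x_j\in G$ and $x_i\cap x_j\ne\emptyset$ for all $i,j$; its degree is $\sum_j\dim(x_j)$. $\Omega^p$ is the real vector space of functions on interacting $k$-tuples of degree $p$ (extended by zero to non-interacting tuples and multilinearly to chains). The exterior derivative is $(dF)(x_1,\dots,x_k)=\sum_{j=1}^k(-1)^{\sum_{i<j}\dim(x_i)}F(x_1,\dots,\delta x_j,\dots,x_k)$, and $H^p_k(G)=\ker(d|_{\Omega^p})/\mathrm{im}(d|_{\Omega^{p-1}})$. An automorphism $T$ of $G$ is a permutation of the vertex set (the union of the elements of $G$) which induces a permutation of $G$; it maps interacting tuples to interacting tuples. $T$ acts on forms by pullback $(U_TF)(x_1,\dots,x_k)=F(T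 x_1,\dots,T x_k)$, where $Tx$ for oriented $x=(v_0,\dots,v_m)$ is the oriented simplex $(Tv_0,\dots,Tv_m)$ (equal to $\pm$ the chosen orientation of the simplex $T(x)$); $U_T$ commutes with $d$ and induces linear maps on each $H^p_k(G)$. The Lefschetz number is $\chi_T(G)=\sum_p(-1)^p\,\mathrm{tr}(U_T|_{H^p_k(G)})$. For a simplex $x$ with $T(x)=x$, $\mathrm{sign}(T|x)$ is the sign of the permutation that $T$ induces on the vertices of $x$. *)

theory Defs
  imports Complex_Main
    "HOL-Combinatorics.Orbits"
    "HOL-Library.Groups_Big_Fun"
    "HOL-Algebra.AbelCoset"
    "Jordan_Normal_Form.Missing_VectorSpace"
begin

section \<open>Linear algebra: quotients, induced maps, trace\<close>

abbreviation real_field :: "real ring" where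
  "real_field \<equiv> \<lparr>carrier = UNIV, mult = (*), one = 1, zero = 0, add = (+)\<rparr>"

text \<open>
  The quotient of a module by a submodule \<open>W\<close>, whose elements are cosets. Adding \<open>W\<close> after
  scaling only matters for the scalar zero, where \<open>{0 \<odot> x | x \<in> X}\<close> is \<open>{\<zero>}\<close> instead of \<open>W\<close>.
  The ring fields \<open>mult\<close> and \<open>one\<close> have no meaning for a module.
\<close>
definition quotient_module :: "('k, 'v) module \<Rightarrow> 'v set \<Rightarrow> ('k, 'v set) module" where
  "quotient_module V W =
     \<lparr>carrier = a_rcosets\<^bsub>V\<^esub> W, mult = undefined, one = undefined,
      zero = W, add = set_add V, smult = (\<lambda>c X. \<Union>x\<in>X. W +>\<^bsub>V\<^esub> (c \<odot>\<^bsub>V\<^esub> x))\<rparr>"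

definition induced_map :: "('k, 'v) module \<Rightarrow> 'v set \<Rightarrow> ('v \<Rightarrow> 'v) \<Rightarrow> 'v set \<Rightarrow> 'v set" where
  "induced_map V W f X = (\<Union>x\<in>X. W +>\<^bsub>V\<^esub> f x)"

definition coords :: "(real, 'v) module \<Rightarrow> 'v set \<Rightarrow> 'v \<Rightarrow> 'v \<Rightarrow> real" where
  "coords V B v = (THE a. a \<in> extensional B \<and> module.lincomb V a B = v)"

text \<open>
  The trace of an endomorphism of a finite-dimensional real vector space is the sum of the
  diagonal entries of its matrix in a basis; it does not depend on the basis chosen.
\<close>
definition lin_trace :: "(real, 'v) module \<Rightarrow> ('v \<Rightarrow> 'v) \<Rightarrow> real" where
  "lin_trace V f =
     (let B = (SOME B. finite B \<and> vectorspace.basis real_field V B)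
      in \<Sum>b\<in>B. coords V B (f b) b)"


section \<open>Simplicial complexes and interacting tuples\<close>

definition simplicial_complex :: "'a set set \<Rightarrow> bool" where
  "simplicial_complex G \<longleftrightarrow>
     finite G \<and> (\<forall>x\<in>G. finite x \<and> x \<noteq> {} \<and> (\<forall>y. y \<noteq> {} \<and> y \<subseteq> x \<longrightarrow> y \<in> G))"

definition sdim :: "'a set \<Rightarrow> nat" where
  "sdim x = card x - 1"

text \<open>A \<open>k\<close>-tuple of simplices is a list of length \<open>k\<close>; indices start at \<open>0\<close>.\<close>

definition interacting :: "'a set set \<Rightarrow> nat \<Rightarrow> 'a set list set" where
  "interacting G k =
     {xs. length xs = k \<and> set xs \<subseteq> G \<and> (\<forall>i<k. \<forall>j<k. xs ! i \<inter> xs ! j \<noteq> {})}"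

definition tuple_degree :: "'a set list \<Rightarrow> nat" where
  "tuple_degree xs = (\<Sum>j<length xs. sdim (xs ! j))"


section \<open>Orientations\<close>

text \<open>
  An oriented simplex is given by a list of its distinct vertices, and an orientation of the
  complex by the choice of such a list for every simplex. Two lists of the same vertices differ
  by the sign of the permutation between them.
\<close>
definition orientation :: "'a set set \<Rightarrow> ('a set \<Rightarrow> 'a list) \<Rightarrow> bool" where
  "orientation G ori \<longleftrightarrow> (\<forall>x\<in>G. distinct (ori x) \<and> set (ori x) = x)"

definition orient_sign :: "'a list \<Rightarrow> 'a list \<Rightarrow> int" where
  "orient_sign vs ws = sign (THE \<pi>. \<pi> permutes set vs \<and> map \<pi> vs = ws)"

text \<open>The chain \<open>\<delta> x\<close>, as a list of oriented simplices with their coefficients.\<close>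
definition boundary :: "'a list \<Rightarrow> (real \<times> 'a list) list" where
  "boundary vs =
     (if length vs \<le> 1 then []
      else map (\<lambda>i. ((-1) ^ i, take i vs @ drop (Suc i) vs)) [0..<length vs])"


section \<open>Forms, exterior derivative and pullback\<close>

type_synonym 'a form = "'a set list \<Rightarrow> real"

text \<open>
  The value of a form on a tuple of oriented simplices, each of which carries the chosen
  orientation or the opposite one.
\<close>
definition oriented_value :: "('a set \<Rightarrow> 'a list) \<Rightarrow> 'a form \<Rightarrow> 'a list list \<Rightarrow> real" where
  "oriented_value ori F vss =
     (\<Prod>j<length vss. of_int (orient_sign (ori (set (vss ! j))) (vss ! j))) * F (map set vss)"

text \<open>\<open>\<Omega>\<^sup>p\<close>: a form is extended by zero from the interacting tuples of degree \<open>p\<close>.\<close>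
definition forms :: "'a set set \<Rightarrow> nat \<Rightarrow> nat \<Rightarrow> (real, 'a form) module" where
  "forms G k p =
     \<lparr>carrier = {F. \<forall>xs. \<not> (xs \<in> interacting G k \<and> tuple_degree xs = p) \<longrightarrow> F xs = 0},
      mult = undefined, one = undefined,
      zero = (\<lambda>xs. 0), add = (\<lambda>F H xs. F xs + H xs), smult = (\<lambda>c F xs. c * F xs)\<rparr>"

definition ext_deriv ::
    "'a set set \<Rightarrow> nat \<Rightarrow> ('a set \<Rightarrow> 'a list) \<Rightarrow> 'a form \<Rightarrow> 'a form" where
  "ext_deriv G k ori F xs =
     (if xs \<in> interacting G k
      then \<Sum>j<k. (-1) ^ (\<Sum>i<j. sdim (xs ! i)) *
             (\<Sum>(c, vs)\<leftarrow>boundary (ori (xs ! j)). c * oriented_value ori F ((map ori xs)[j := vs]))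
      else 0)"

definition pullback ::
    "'a set set \<Rightarrow> nat \<Rightarrow> ('a set \<Rightarrow> 'a list) \<Rightarrow> ('a \<Rightarrow> 'a) \<Rightarrow> 'a form \<Rightarrow> 'a form" where
  "pullback G k ori T F xs =
     (if xs \<in> interacting G k
      then oriented_value ori F (map (\<lambda>x. map T (ori x)) xs)
      else 0)"


section \<open>Interaction cohomology and the Lefschetz number\<close>

definition cocycles ::
    "'a set set \<Rightarrow> nat \<Rightarrow> ('a set \<Rightarrow> 'a list) \<Rightarrow> nat \<Rightarrow> (real, 'a form) module" where
  "cocycles G k ori p =
     (forms G k p)\<lparr>carrier := {F \<in> carrier (forms G k p). ext_deriv G k ori F = (\<lambda>xs. 0)}\<rparr>"

fun coboundaries ::
    "'a set set \<Rightarrow> nat \<Rightarrow> ('a set \<Rightarrow> 'a list) \<Rightarrow> nat \<Rightarrow> 'a form set" where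
  "coboundaries G k ori 0 = {\<lambda>xs. 0}"
| "coboundaries G k ori (Suc p) = ext_deriv G k ori ` carrier (forms G k p)"

definition cohomology ::
    "'a set set \<Rightarrow> nat \<Rightarrow> ('a set \<Rightarrow> 'a list) \<Rightarrow> nat \<Rightarrow> (real, 'a form set) module" where
  "cohomology G k ori p = quotient_module (cocycles G k ori p) (coboundaries G k ori p)"

definition cohomology_map ::
    "'a set set \<Rightarrow> nat \<Rightarrow> ('a set \<Rightarrow> 'a list) \<Rightarrow> ('a \<Rightarrow> 'a) \<Rightarrow> nat \<Rightarrow> 'a form set \<Rightarrow> 'a form set"
where
  "cohomology_map G k ori T p =
     induced_map (cocycles G k ori p) (coboundaries G k ori p) (pullback G k ori T)"

text \<open>
  The sum extends over all degrees; \<open>\<Omega>\<^sup>p\<close> is the zero space for all but finitely many \<open>p\<close>.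
\<close>
definition lefschetz_number ::
    "'a set set \<Rightarrow> nat \<Rightarrow> ('a set \<Rightarrow> 'a list) \<Rightarrow> ('a \<Rightarrow> 'a) \<Rightarrow> real" where
  "lefschetz_number G k ori T =
     Sum_any (\<lambda>p. (-1) ^ p * lin_trace (cohomology G k ori p) (cohomology_map G k ori T p))"


section \<open>Automorphisms and the index\<close>

definition automorphism :: "'a set set \<Rightarrow> ('a \<Rightarrow> 'a) \<Rightarrow> bool" where
  "automorphism G T \<longleftrightarrow> T permutes \<Union>G \<and> bij_betw ((`) T) G G"

definition fixed_tuples :: "'a set set \<Rightarrow> nat \<Rightarrow> ('a \<Rightarrow> 'a) \<Rightarrow> 'a set list set" where
  "fixed_tuples G k T = {xs \<in> interacting G k. \<forall>j<k. T ` (xs ! j) = xs ! j}"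

definition tuple_index :: "nat \<Rightarrow> ('a \<Rightarrow> 'a) \<Rightarrow> 'a set list \<Rightarrow> real" where
  "tuple_index k T xs =
     (\<Prod>j<k. (-1) ^ sdim (xs ! j) * of_int (sign (perm_restrict T (xs ! j))))"

end

theory Submission
  imports Defs
begin

text \<open>
  The equality is the Hopf trace formula followed by reading off the diagonal of the pullback on
  \<open>\<Omega>\<^sup>p\<close>. Choose linear maps \<open>s\<^sub>p : \<Omega>\<^sup>p\<^sup>+\<^sup>1 \<rightarrow> \<Omega>\<^sup>p\<close> with \<open>d s\<^sub>p d = d\<close> on \<open>\<Omega>\<^sup>p\<close>. Then
  \<open>1 - s\<^sub>p d\<close> projects onto the cocycles and \<open>d s\<^sub>p\<^sub>-\<^sub>1\<close> onto the coboundaries, so the trace on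
  \<open>H\<^sup>p\<close> is \<open>tr(U) - tr(U s\<^sub>p d) - tr(U d s\<^sub>p\<^sub>-\<^sub>1)\<close>. As \<open>tr(U s\<^sub>p d) = tr(d U s\<^sub>p) = tr(U d s\<^sub>p)\<close>,
  the correction terms cancel in the alternating sum.

  That \<open>d\<close> squares to zero and commutes with the pullback becomes a computation with faces once the
  orientation signs are split: for any injective labelling \<open>h\<close> of the vertices, the sign between
  two orderings of a simplex is the product of their inversion parities with respect to \<open>h\<close>.
\<close>

section \<open>Traces of linear maps on finitely supported functions\<close>

definition supported_on :: "'b set \<Rightarrow> ('b \<Rightarrow> real) set" where
  "supported_on I = {F. \<forall>x. x \<notin> I \<longrightarrow> F x = 0}"

definition point_fun :: "'b \<Rightarrow> 'b \<Rightarrow> real" where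
  "point_fun x = (\<lambda>y. if y = x then 1 else 0)"

definition fun_linear :: "(('b \<Rightarrow> real) \<Rightarrow> 'c \<Rightarrow> real) \<Rightarrow> bool" where
  "fun_linear A \<longleftrightarrow>
     (\<forall>F H. A (\<lambda>x. F x + H x) = (\<lambda>y. A F y + A H y)) \<and>
     (\<forall>c F. A (\<lambda>x. c * F x) = (\<lambda>y. c * A F y))"

definition fun_subspace :: "('b \<Rightarrow> real) set \<Rightarrow> bool" where
  "fun_subspace S \<longleftrightarrow>
     (\<lambda>x. 0) \<in> S \<and> (\<forall>F\<in>S. \<forall>H\<in>S. (\<lambda>x. F x + H x) \<in> S) \<and> (\<forall>c. \<forall>F\<in>S. (\<lambda>x. c * F x) \<in> S)"

lemma fun_linear_add: "fun_linear A \<Longrightarrow> A (\<lambda>x. F x + H x) = (\<lambda>y. A F y + A H y)"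
  and fun_linear_scale: "fun_linear A \<Longrightarrow> A (\<lambda>x. c * F x) = (\<lambda>y. c * A F y)"
  by (auto simp: fun_linear_def)

lemma fun_linear_zero: "fun_linear A \<Longrightarrow> A (\<lambda>x. 0) = (\<lambda>y. 0)"
  using fun_linear_scale[of A 0] by simp

lemma fun_linear_diff:
  assumes "fun_linear A" shows "A (\<lambda>x. F x - H x) = (\<lambda>y. A F y - A H y)"
  using fun_linear_add[OF assms, of F "\<lambda>x. - 1 * H x"] fun_linear_scale[OF assms, of "- 1" H]
  by simp

lemma fun_linear_comp: "fun_linear A \<Longrightarrow> fun_linear B \<Longrightarrow> fun_linear (\<lambda>F. A (B F))"
  by (simp add: fun_linear_def)

lemma fun_subspace_zero: "fun_subspace S \<Longrightarrow> (\<lambda>x. 0) \<in> S"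
  and fun_subspace_add: "fun_subspace S \<Longrightarrow> F \<in> S \<Longrightarrow> H \<in> S \<Longrightarrow> (\<lambda>x. F x + H x) \<in> S"
  and fun_subspace_scale: "fun_subspace S \<Longrightarrow> F \<in> S \<Longrightarrow> (\<lambda>x. c * F x) \<in> S"
  by (auto simp: fun_subspace_def)

lemma fun_subspace_diff:
  assumes "fun_subspace S" "F \<in> S" "H \<in> S" shows "(\<lambda>x. F x - H x) \<in> S"
  using fun_subspace_add[OF assms(1,2) fun_subspace_scale[OF assms(1,3), of "- 1"]] by simp

lemma fun_subspace_supported_on: "fun_subspace (supported_on I)"
  by (auto simp: fun_subspace_def supported_on_def)

lemma fun_subspace_image:
  assumes "fun_linear A" "fun_subspace S" shows "fun_subspace (A ` S)"
  unfolding fun_subspace_def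
proof (intro conjI ballI allI)
  show "(\<lambda>x. 0) \<in> A ` S"
    using fun_linear_zero[OF assms(1)] fun_subspace_zero[OF assms(2)] by (intro image_eqI) auto
next
  fix F H assume "F \<in> A ` S" "H \<in> A ` S"
  then obtain F' H' where "F' \<in> S" "H' \<in> S" "F = A F'" "H = A H'" by blast
  then show "(\<lambda>x. F x + H x) \<in> A ` S"
    by (intro image_eqI[OF _ fun_subspace_add[OF assms(2), of F' H']])
      (auto simp: fun_linear_add[OF assms(1)])
next
  fix c F assume "F \<in> A ` S"
  then obtain F' where "F' \<in> S" "F = A F'" by blast
  then show "(\<lambda>x. c * F x) \<in> A ` S"
    by (intro image_eqI[OF _ fun_subspace_scale[OF assms(2), of F' c]])
      (auto simp: fun_linear_scale[OF assms(1)])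
qed

section \<open>Expansion of finitely supported functions in point functions\<close>

lemma point_fun_supported: "x \<in> I \<Longrightarrow> point_fun x \<in> supported_on I"
  by (auto simp: point_fun_def supported_on_def)

lemma supported_on_mono: "I \<subseteq> J \<Longrightarrow> F \<in> supported_on I \<Longrightarrow> F \<in> supported_on J"
  by (auto simp: supported_on_def)

lemma supported_on_induct [consumes 2, case_names zero step]:
  assumes "finite I" "F \<in> supported_on I" and zero: "P (\<lambda>x. 0)"
    and step: "\<And>F c x. F \<in> supported_on I \<Longrightarrow> P F \<Longrightarrow> x \<in> I \<Longrightarrow> P (\<lambda>y. F y + c * point_fun x y)"
  shows "P F"
proof -
  have "P F" if "J \<subseteq> I" "F \<in> supported_on J" for J F
    using finite_subset[OF that(1) assms(1)] that
  proof (induction J arbitrary: F rule: finite_induct)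
    case empty
    then have "F = (\<lambda>x. 0)" by (auto simp: supported_on_def)
    then show ?case using zero by simp
  next
    case (insert x J)
    define F' where "F' = F(x := 0)"
    have F': "F' \<in> supported_on J"
      using insert.prems(2) by (auto simp: F'_def supported_on_def)
    have "F = (\<lambda>y. F' y + F x * point_fun x y)"
      by (auto simp: F'_def point_fun_def)
    moreover have "P (\<lambda>y. F' y + F x * point_fun x y)"
      using insert.prems(1) F' supported_on_mono[of J I F'] by (intro step insert.IH) auto
    ultimately show ?case by simp
  qed
  then show ?thesis using assms(2) by blast
qed

text \<open>Linearity is demanded on \<open>supported_on I\<close> only, because the functional in
  the trace computation on a quotient is a composite that passes through \<open>carrier V\<close>
  and is known to be linear only there.\<close>

lemma functional_expansion:
  assumes "finite I" "F \<in> supported_on I"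
    and add: "\<And>F H. F \<in> supported_on I \<Longrightarrow> H \<in> supported_on I \<Longrightarrow> L (\<lambda>x. F x + H x) = L F + L H"
    and scale: "\<And>c F. F \<in> supported_on I \<Longrightarrow> L (\<lambda>x. c * F x) = c * (L F :: real)"
  shows "L F = (\<Sum>x\<in>I. F x * L (point_fun x))"
  using assms(1,2)
proof (induction rule: supported_on_induct)
  case zero
  show ?case using scale[OF fun_subspace_zero[OF fun_subspace_supported_on], of 0] by simp
next
  case (step F c x)
  have "L (\<lambda>y. F y + c * point_fun x y) = L F + c * L (point_fun x)"
    by (simp add: add scale step fun_subspace_scale[OF fun_subspace_supported_on] point_fun_supported)
  also have "c * L (point_fun x) = (\<Sum>y\<in>I. c * point_fun x y * L (point_fun y))"
  proof -
    have "c * point_fun x y * L (point_fun y) = (if x = y then c * L (point_fun x) else 0)" for y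
      by (simp add: point_fun_def)
    then show ?thesis using assms(1) step by simp
  qed
  finally show ?case
    using step by (simp add: sum.distrib algebra_simps)
qed

lemma fun_linear_expansion:
  assumes "finite I" "F \<in> supported_on I" "fun_linear A"
  shows "A F y = (\<Sum>x\<in>I. F x * A (point_fun x) y)"
  using assms fun_linear_add[OF assms(3)] fun_linear_scale[OF assms(3)]
  by (intro functional_expansion[where L = "\<lambda>F. A F y"]) auto

text \<open>If \<open>A\<close> is linear and maps \<open>supported_on I\<close> into itself, with
  \<open>I\<close> finite, this is the trace of that restriction, read off in the basis of point
  functions.\<close>

definition fun_trace :: "'b set \<Rightarrow> (('b \<Rightarrow> real) \<Rightarrow> 'b \<Rightarrow> real) \<Rightarrow> real" where
  "fun_trace I A = (\<Sum>x\<in>I. A (point_fun x) x)"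

text \<open>Both traces are the same double sum over products of matrix entries. The index sets may
  differ, which allows a trace to pass from one degree of a complex to the next.\<close>

lemma fun_trace_commute:
  assumes "finite I" "finite J" "fun_linear A" "fun_linear B"
    and "\<And>x. x \<in> I \<Longrightarrow> B (point_fun x) \<in> supported_on J"
    and "\<And>y. y \<in> J \<Longrightarrow> A (point_fun y) \<in> supported_on I"
  shows "fun_trace I (\<lambda>F. A (B F)) = fun_trace J (\<lambda>F. B (A F))"
proof -
  have "fun_trace I (\<lambda>F. A (B F)) = (\<Sum>x\<in>I. \<Sum>y\<in>J. B (point_fun x) y * A (point_fun y) x)"
    unfolding fun_trace_def using fun_linear_expansion[OF assms(2) assms(5) assms(3)]
    by (intro sum.cong) auto
  also have "\<dots> = (\<Sum>y\<in>J. \<Sum>x\<in>I. A (point_fun y) x * B (point_fun x) y)"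
    by (subst sum.swap) (simp add: mult.commute)
  also have "\<dots> = fun_trace J (\<lambda>F. B (A F))"
    unfolding fun_trace_def using fun_linear_expansion[OF assms(1) assms(6) assms(4)]
    by (intro sum.cong) auto
  finally show ?thesis .
qed

text \<open>
  Induction on the support: a new point either maps into the image so far, or a functional that
  vanishes on that image and is one at the value of the new point corrects \<open>s\<close>.
\<close>
lemma generalized_inverse:
  fixes D :: "('b \<Rightarrow> real) \<Rightarrow> 'c \<Rightarrow> real"
  assumes "finite I" "fun_linear D"
  shows "\<exists>s. fun_linear s \<and> range s \<subseteq> supported_on I \<and> (\<forall>F\<in>supported_on I. D (s (D F)) = D F)"
  using assms(1)
proof (induction rule: finite_induct)
  case empty
  have "fun_linear (\<lambda>F x. 0)" by (simp add: fun_linear_def)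
  moreover have "range (\<lambda>F x. 0) \<subseteq> supported_on {}" by (auto simp: supported_on_def)
  moreover have "supported_on {} = {\<lambda>x::'b. 0 :: real}" by (auto simp: supported_on_def)
  ultimately show ?case
    using fun_linear_zero[OF assms(2)] by (intro exI[of _ "\<lambda>F x. 0"]) auto
next
  case (insert x I)
  note lin = fun_linear_add[OF assms(2)] fun_linear_scale[OF assms(2)]
  obtain s where s: "fun_linear s" "range s \<subseteq> supported_on I" "\<And>F. F \<in> supported_on I \<Longrightarrow> D (s (D F)) = D F"
    using insert.IH by blast
  note lins = fun_linear_add[OF s(1)] fun_linear_scale[OF s(1)]
  have split: "\<exists>H\<in>supported_on I. \<exists>c. F = (\<lambda>y. H y + c * point_fun x y)"
    if "F \<in> supported_on (insert x I)" for F
    using that by (intro bexI[of _ "F(x := 0)"] exI[of _ "F x"]) (auto simp: supported_on_def point_fun_def)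
  \<comment> \<open>The part of the new value that \<open>s\<close> fails to reproduce; if it
    vanishes, \<open>s\<close> already works on the larger support.\<close>
  define u where "u = (\<lambda>y. D (point_fun x) y - D (s (D (point_fun x))) y)"
  show ?case
  proof (cases "u = (\<lambda>y. 0)")
    case True
    then have "D (s (D (point_fun x))) = D (point_fun x)" by (auto simp: u_def fun_eq_iff)
    then have "D (s (D F)) = D F" if "F \<in> supported_on (insert x I)" for F
      using split[OF that] s(3) by (auto simp: lin lins)
    then show ?thesis using s(1,2) supported_on_mono[of I "insert x I"] by blast
  next
    case False
    then obtain y where y: "u y \<noteq> 0" by auto
    \<comment> \<open>The numerator vanishes on \<open>D F\<close> for \<open>F\<close> supported on
      \<open>I\<close>, where \<open>D s\<close> acts as the identity; the division normalises the
      value at \<open>D (point_fun x)\<close> to one.\<close>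
    define l where "l v = (v y - D (s v) y) / u y" for v
    \<comment> \<open>Chosen so that the corrected map sends \<open>D (point_fun x)\<close> exactly
      to \<open>point_fun x\<close>.\<close>
    define r where "r z = point_fun x z - s (D (point_fun x)) z" for z
    define s' where "s' v = (\<lambda>z. s v z + l v * r z)" for v
    have l_im: "l (D F) = 0" if "F \<in> supported_on I" for F
      using s(3)[OF that] by (simp add: l_def)
    have l_x: "l (D (point_fun x)) = 1"
      using y by (simp add: l_def u_def)
    have "fun_linear s'"
      by (auto simp: fun_linear_def s'_def l_def lin lins algebra_simps add_divide_distrib diff_divide_distrib)
    moreover have "range s' \<subseteq> supported_on (insert x I)"
    proof -
      have "s v z = 0" if "z \<notin> I" for v z using s(2) that by (auto simp: supported_on_def)
      then show ?thesis by (auto simp: supported_on_def s'_def r_def point_fun_def)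
    qed
    moreover have "D (s' (D F)) = D F" if "F \<in> supported_on (insert x I)" for F
    proof -
      obtain H c where H: "H \<in> supported_on I" and F: "F = (\<lambda>y. H y + c * point_fun x y)"
        using split[OF \<open>F \<in> _\<close>] by blast
      have "l (D F) = c"
      proof -
        have "l (D F) = l (D H) + c * l (D (point_fun x))"
          by (simp add: F l_def lin lins algebra_simps add_divide_distrib diff_divide_distrib)
        then show ?thesis using l_im[OF H] l_x by simp
      qed
      then have "s' (D F) = (\<lambda>z. s (D H) z + c * point_fun x z)"
        by (auto simp: s'_def r_def F lin lins algebra_simps)
      then show ?thesis using s(3)[OF H] by (simp add: F lin)
    qed
    ultimately show ?thesis by blast
  qed
qed

section \<open>Traces from frames\<close>

definition functional_on :: "(real, 'v) module \<Rightarrow> ('v \<Rightarrow> real) \<Rightarrow> bool" where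
  "functional_on V \<phi> \<longleftrightarrow>
     (\<forall>x\<in>carrier V. \<forall>y\<in>carrier V. \<phi> (x \<oplus>\<^bsub>V\<^esub> y) = \<phi> x + \<phi> y) \<and>
     (\<forall>c. \<forall>x\<in>carrier V. \<phi> (c \<odot>\<^bsub>V\<^esub> x) = c * \<phi> x)"

lemma functional_on_lincomb:
  assumes V: "vectorspace real_field V" and \<phi>: "functional_on V \<phi>"
    and A: "finite A" "A \<subseteq> carrier V"
  shows "\<phi> (module.lincomb V a A) = (\<Sum>v\<in>A. a v * \<phi> v)"
proof -
  interpret vectorspace real_field V by (rule V)
  show ?thesis
    using A
  proof (induction A rule: finite_induct)
    case empty
    have "\<phi> (0 \<odot>\<^bsub>V\<^esub> \<zero>\<^bsub>V\<^esub>) = 0 * \<phi> \<zero>\<^bsub>V\<^esub>"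
      using \<phi> M.zero_closed unfolding functional_on_def by blast
    then show ?case by (simp add: lincomb_empty)
  next
    case (insert v A)
    have "lincomb a (insert v A) = a v \<odot>\<^bsub>V\<^esub> v \<oplus>\<^bsub>V\<^esub> lincomb a A"
      using insert by (intro lincomb_insert2) auto
    moreover have "lincomb a A \<in> carrier V"
      using insert by (intro lincomb_closed) auto
    moreover have "a v \<odot>\<^bsub>V\<^esub> v \<in> carrier V" "v \<in> carrier V"
      using insert smult_closed by auto
    ultimately show ?case
      using insert \<phi> by (simp add: functional_on_def)
  qed
qed

lemma coords_basis:
  assumes V: "vectorspace real_field V" and B: "finite B" "vectorspace.basis real_field V B"
    and v: "v \<in> carrier V"
  shows "coords V B v \<in> extensional B" "module.lincomb V (coords V B v) B = v"
    and coords_unique: "a \<in> extensional B \<Longrightarrow> module.lincomb V a B = v \<Longrightarrow> coords V B v = a"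
proof -
  interpret vectorspace real_field V by (rule V)
  have "B \<subseteq> carrier V" using B(2) basis_def by blast
  then have ex: "\<exists>!a. a \<in> extensional B \<and> lincomb a B = v"
    using basis_criterion[OF B(1)] B(2) v by (simp add: PiE_def)
  show "coords V B v \<in> extensional B" "lincomb (coords V B v) B = v"
    using theI'[OF ex] by (auto simp: coords_def)
  show "coords V B v = a" if "a \<in> extensional B" "lincomb a B = v"
    unfolding coords_def using that by (intro the1_equality[OF ex]) auto
qed

lemma functional_on_coords:
  assumes V: "vectorspace real_field V" and B: "finite B" "vectorspace.basis real_field V B"
    and b: "b \<in> B"
  shows "functional_on V (\<lambda>v. coords V B v b)"
proof -
  interpret vectorspace real_field V by (rule V)
  have BV: "B \<subseteq> carrier V" using B(2) basis_def by blast
  note co = coords_basis[OF V B]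
  show ?thesis
    unfolding functional_on_def
  proof (intro conjI ballI allI)
    fix x y assume xy: "x \<in> carrier V" "y \<in> carrier V"
    let ?a = "restrict (\<lambda>b. coords V B x b + coords V B y b) B"
    have "lincomb ?a B = lincomb (\<lambda>b. coords V B x b + coords V B y b) B"
      using BV by (intro lincomb_cong) auto
    also have "\<dots> = lincomb (coords V B x) B \<oplus>\<^bsub>V\<^esub> lincomb (coords V B y) B"
      using lincomb_sum[OF B(1) BV, of "coords V B x" "coords V B y"] by simp
    also have "\<dots> = x \<oplus>\<^bsub>V\<^esub> y" using co(2) xy by simp
    finally have "coords V B (x \<oplus>\<^bsub>V\<^esub> y) = ?a"
      using xy by (intro co(3)) auto
    then show "coords V B (x \<oplus>\<^bsub>V\<^esub> y) b = coords V B x b + coords V B y b"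
      using b by simp
  next
    fix c x assume x: "x \<in> carrier V"
    let ?a = "restrict (\<lambda>b. c * coords V B x b) B"
    have "lincomb ?a B = lincomb (\<lambda>b. c * coords V B x b) B"
      using BV by (intro lincomb_cong) auto
    also have "\<dots> = c \<odot>\<^bsub>V\<^esub> lincomb (coords V B x) B"
      using lincomb_smult[OF BV, of "coords V B x" c] by simp
    also have "\<dots> = c \<odot>\<^bsub>V\<^esub> x" using co(2) x by simp
    finally have "coords V B (c \<odot>\<^bsub>V\<^esub> x) = ?a"
      using x smult_closed by (intro co(3)) auto
    then show "coords V B (c \<odot>\<^bsub>V\<^esub> x) b = c * coords V B x b"
      using b by simp
  qed
qed

text \<open>
  A frame need not be linearly independent; expanding with respect to a basis and with respect
  to the frame yields the same double sum.
\<close>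
lemma lin_trace_frame:
  fixes v :: "'i \<Rightarrow> 'v"
  assumes V: "vectorspace real_field V" "vectorspace.fin_dim real_field V"
    and I: "finite I" "\<And>i. i \<in> I \<Longrightarrow> v i \<in> carrier V"
    and \<phi>: "\<And>i. i \<in> I \<Longrightarrow> functional_on V (\<phi> i)"
    and frame: "\<And>\<psi> x. functional_on V \<psi> \<Longrightarrow> x \<in> carrier V \<Longrightarrow> \<psi> x = (\<Sum>i\<in>I. \<phi> i x * \<psi> (v i))"
    and f: "\<And>x. x \<in> carrier V \<Longrightarrow> f x \<in> carrier V"
      "\<And>x y. x \<in> carrier V \<Longrightarrow> y \<in> carrier V \<Longrightarrow> f (x \<oplus>\<^bsub>V\<^esub> y) = f x \<oplus>\<^bsub>V\<^esub> f y"
      "\<And>c x. x \<in> carrier V \<Longrightarrow> f (c \<odot>\<^bsub>V\<^esub> x) = c \<odot>\<^bsub>V\<^esub> f x"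
  shows "lin_trace V f = (\<Sum>i\<in>I. \<phi> i (f (v i)))"
proof -
  interpret vectorspace real_field V by (rule V(1))
  define B where "B = (SOME B. finite B \<and> basis B)"
  have "\<exists>B. finite B \<and> basis B" using finite_basis_exists[OF V(2)] .
  then have B: "finite B" "basis B" unfolding B_def by (metis (mono_tags, lifting) someI_ex)+
  have BV: "B \<subseteq> carrier V" using B(2) basis_def by blast
  note lin = functional_on_coords[OF V(1) B]
  have "lin_trace V f = (\<Sum>b\<in>B. coords V B (f b) b)"
    by (simp add: lin_trace_def B_def Let_def)
  also have "\<dots> = (\<Sum>b\<in>B. \<Sum>i\<in>I. \<phi> i b * coords V B (f (v i)) b)"
  proof (intro sum.cong refl)
    fix b assume b: "b \<in> B"
    \<comment> \<open>A coordinate of \<open>f x\<close> is again a functional of \<open>x\<close>,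
      so the frame identity applies to it at \<open>x = b\<close>.\<close>
    have "functional_on V (\<lambda>x. coords V B (f x) b)"
      using lin[OF b] f by (simp add: functional_on_def)
    then show "coords V B (f b) b = (\<Sum>i\<in>I. \<phi> i b * coords V B (f (v i)) b)"
      using frame b BV by auto
  qed
  also have "\<dots> = (\<Sum>i\<in>I. \<Sum>b\<in>B. coords V B (f (v i)) b * \<phi> i b)"
    by (subst sum.swap) (simp add: mult.commute)
  also have "\<dots> = (\<Sum>i\<in>I. \<phi> i (f (v i)))"
  proof (intro sum.cong refl)
    fix i assume i: "i \<in> I"
    show "(\<Sum>b\<in>B. coords V B (f (v i)) b * \<phi> i b) = \<phi> i (f (v i))"
      using functional_on_lincomb[OF V(1) \<phi>[OF i] B(1) BV, of "coords V B (f (v i))"]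
        coords_basis(2)[OF V(1) B f(1)[OF I(2)[OF i]]] by simp
  qed
  finally show ?thesis .
qed

lemma field_real_field: "field real_field"
proof -
  have inv: "\<exists>y. x * y = 1" if "x \<noteq> 0" for x :: real
    using that by (intro exI[of _ "inverse x"]) simp
  have neg: "\<exists>y. x + y = 0" for x :: real
    by (rule exI[of _ "- x"]) simp
  show ?thesis
    by unfold_locales (auto simp: Units_def algebra_simps neg inv intro: exI[of _ "- _"])
qed

section \<open>Quotients of function spaces\<close>

text \<open>The fields agree with those of \<open>forms\<close>, including the undefined ones, so
  that the module of cocycles is literally equal to an instance.\<close>

definition fun_module :: "('b \<Rightarrow> real) set \<Rightarrow> (real, 'b \<Rightarrow> real) module" where
  "fun_module S =
     \<lparr>carrier = S, mult = undefined, one = undefined,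
      zero = (\<lambda>x. 0), add = (\<lambda>F H x. F x + H x), smult = (\<lambda>c F x. c * F x)\<rparr>"

definition fun_coset :: "('b \<Rightarrow> real) set \<Rightarrow> ('b \<Rightarrow> real) \<Rightarrow> ('b \<Rightarrow> real) set" where
  "fun_coset W z = (\<lambda>w x. w x + z x) ` W"

lemma a_r_coset_fun_module: "W +>\<^bsub>fun_module Z\<^esub> z = fun_coset W z"
  by (auto simp: a_r_coset_def' fun_coset_def fun_module_def)

locale fun_quotient =
  fixes Z W :: "('b \<Rightarrow> real) set"
  assumes subspace_Z: "fun_subspace Z" and subspace_W: "fun_subspace W" and W_subset_Z: "W \<subseteq> Z"
begin

abbreviation V where "V \<equiv> quotient_module (fun_module Z) W"

section \<open>Cosets and the vector space structure of the quotient\<close>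

lemma mem_fun_coset: "y \<in> fun_coset W z \<longleftrightarrow> (\<lambda>x. y x - z x) \<in> W"
proof
  assume "(\<lambda>x. y x - z x) \<in> W"
  then show "y \<in> fun_coset W z"
    unfolding fun_coset_def by (rule image_eqI[rotated]) simp
qed (auto simp: fun_coset_def)

lemma fun_coset_self: "z \<in> fun_coset W z"
  using fun_subspace_zero[OF subspace_W] by (simp add: mem_fun_coset)

lemma fun_coset_eq_iff: "fun_coset W z = fun_coset W z' \<longleftrightarrow> (\<lambda>x. z x - z' x) \<in> W"
proof
  assume "fun_coset W z = fun_coset W z'"
  then show "(\<lambda>x. z x - z' x) \<in> W" using fun_coset_self[of z] by (simp add: mem_fun_coset)
next
  assume d: "(\<lambda>x. z x - z' x) \<in> W"
  have "(\<lambda>x. y x - z' x) \<in> W" if "(\<lambda>x. y x - z x) \<in> W" for y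
    using fun_subspace_add[OF subspace_W that d] by simp
  moreover have "(\<lambda>x. y x - z x) \<in> W" if "(\<lambda>x. y x - z' x) \<in> W" for y
    using fun_subspace_diff[OF subspace_W that d] by simp
  ultimately show "fun_coset W z = fun_coset W z'" by (auto simp: mem_fun_coset)
qed

lemma carrier_V: "carrier V = fun_coset W ` Z"
  by (auto simp: quotient_module_def A_RCOSETS_def' a_r_coset_fun_module) (auto simp: fun_module_def)

lemma zero_V: "\<zero>\<^bsub>V\<^esub> = fun_coset W (\<lambda>x. 0)"
  by (simp add: quotient_module_def fun_coset_def)

lemma add_V: "fun_coset W z \<oplus>\<^bsub>V\<^esub> fun_coset W z' = fun_coset W (\<lambda>x. z x + z' x)"
proof -
  have "fun_coset W z \<oplus>\<^bsub>V\<^esub> fun_coset W z'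
      = (\<Union>F\<in>fun_coset W z. \<Union>H\<in>fun_coset W z'. {\<lambda>x. F x + H x})"
    by (simp add: quotient_module_def set_add_def' fun_module_def)
  also have "\<dots> = fun_coset W (\<lambda>x. z x + z' x)"
  proof (intro equalityI subsetI)
    fix y assume "y \<in> (\<Union>F\<in>fun_coset W z. \<Union>H\<in>fun_coset W z'. {\<lambda>x. F x + H x})"
    then obtain F H where FH: "F \<in> fun_coset W z" "H \<in> fun_coset W z'" "y = (\<lambda>x. F x + H x)"
      by blast
    then have "(\<lambda>x. F x - z x) \<in> W" "(\<lambda>x. H x - z' x) \<in> W" by (auto simp: mem_fun_coset)
    from fun_subspace_add[OF subspace_W this] show "y \<in> fun_coset W (\<lambda>x. z x + z' x)"
      by (simp add: mem_fun_coset FH(3) algebra_simps)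
  next
    fix y assume y: "y \<in> fun_coset W (\<lambda>x. z x + z' x)"
    then have "(\<lambda>x. y x - z' x) \<in> fun_coset W z"
      by (simp add: mem_fun_coset algebra_simps)
    then show "y \<in> (\<Union>F\<in>fun_coset W z. \<Union>H\<in>fun_coset W z'. {\<lambda>x. F x + H x})"
      using fun_coset_self[of z'] by force
  qed
  finally show ?thesis .
qed

text \<open>Since \<open>f\<close> preserves \<open>W\<close>, all representatives of a class yield
  the same coset, and the union in \<open>induced_map\<close> collapses to it.\<close>

lemma induced_map_fun_coset:
  assumes "fun_linear f" "\<And>w. w \<in> W \<Longrightarrow> f w \<in> W"
  shows "induced_map (fun_module Z) W f (fun_coset W z) = fun_coset W (f z)"
proof -
  have "fun_coset W (f y) = fun_coset W (f z)" if "y \<in> fun_coset W z" for y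
  proof -
    have "f (\<lambda>x. y x - z x) \<in> W" using assms(2) that by (simp add: mem_fun_coset)
    then show ?thesis by (simp add: fun_coset_eq_iff fun_linear_diff[OF assms(1)])
  qed
  then show ?thesis
    unfolding induced_map_def a_r_coset_fun_module using fun_coset_self by blast
qed

lemma smult_V: "c \<odot>\<^bsub>V\<^esub> fun_coset W z = fun_coset W (\<lambda>x. c * z x)"
proof -
  \<comment> \<open>Scaling in \<open>quotient_module\<close> has the shape of an induced map, so
    the preceding lemma covers it, the scalar zero included.\<close>
  have "fun_linear (\<lambda>F x. c * F x)" by (auto simp: fun_linear_def algebra_simps)
  from induced_map_fun_coset[OF this fun_subspace_scale[OF subspace_W]] show ?thesis
    by (simp add: quotient_module_def induced_map_def a_r_coset_fun_module fun_module_def)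
qed

lemma vectorspace_V: "vectorspace real_field V"
proof -
  note closed = fun_subspace_zero[OF subspace_Z] fun_subspace_add[OF subspace_Z] fun_subspace_scale[OF subspace_Z]
  have "abelian_group V"
  proof (rule abelian_groupI)
    fix X assume "X \<in> carrier V"
    then obtain z where z: "X = fun_coset W z" "z \<in> Z" by (auto simp: carrier_V)
    show "\<exists>Y\<in>carrier V. Y \<oplus>\<^bsub>V\<^esub> X = \<zero>\<^bsub>V\<^esub>"
      using z closed(3)[OF z(2), of "- 1"]
      by (intro bexI[of _ "fun_coset W (\<lambda>x. - 1 * z x)"]) (auto simp: carrier_V add_V zero_V)
    show "\<zero>\<^bsub>V\<^esub> \<oplus>\<^bsub>V\<^esub> X = X" by (simp add: z zero_V add_V)
    fix Y assume "Y \<in> carrier V"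
    then obtain y where y: "Y = fun_coset W y" "y \<in> Z" by (auto simp: carrier_V)
    show "X \<oplus>\<^bsub>V\<^esub> Y \<in> carrier V" using closed(2)[OF z(2) y(2)] by (simp add: z y add_V carrier_V)
    show "X \<oplus>\<^bsub>V\<^esub> Y = Y \<oplus>\<^bsub>V\<^esub> X" by (simp add: z y add_V add.commute)
    fix U assume "U \<in> carrier V"
    then obtain u where u: "U = fun_coset W u" by (auto simp: carrier_V)
    show "X \<oplus>\<^bsub>V\<^esub> Y \<oplus>\<^bsub>V\<^esub> U = X \<oplus>\<^bsub>V\<^esub> (Y \<oplus>\<^bsub>V\<^esub> U)"
      by (simp add: z y u add_V add.assoc)
  next
    show "\<zero>\<^bsub>V\<^esub> \<in> carrier V" using closed(1) by (simp add: zero_V carrier_V)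
  qed
  then show ?thesis
  proof (intro vectorspace.intro moduleI)
    show "cring real_field" "field real_field"
      using field_real_field by (auto simp: field_def domain_def)
    fix X a b assume "X \<in> carrier V"
    then obtain z where z: "X = fun_coset W z" "z \<in> Z" by (auto simp: carrier_V)
    show "a \<odot>\<^bsub>V\<^esub> X \<in> carrier V" using closed(3)[OF z(2)] by (simp add: z smult_V carrier_V)
    show "(a \<oplus>\<^bsub>real_field\<^esub> b) \<odot>\<^bsub>V\<^esub> X = a \<odot>\<^bsub>V\<^esub> X \<oplus>\<^bsub>V\<^esub> b \<odot>\<^bsub>V\<^esub> X"
      by (simp add: z smult_V add_V distrib_right)
    show "(a \<otimes>\<^bsub>real_field\<^esub> b) \<odot>\<^bsub>V\<^esub> X = a \<odot>\<^bsub>V\<^esub> (b \<odot>\<^bsub>V\<^esub> X)"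
      by (simp add: z smult_V mult.assoc)
    show "\<one>\<^bsub>real_field\<^esub> \<odot>\<^bsub>V\<^esub> X = X" by (simp add: z smult_V)
    fix Y assume "Y \<in> carrier V"
    then obtain y where y: "Y = fun_coset W y" by (auto simp: carrier_V)
    show "a \<odot>\<^bsub>V\<^esub> (X \<oplus>\<^bsub>V\<^esub> Y) = a \<odot>\<^bsub>V\<^esub> X \<oplus>\<^bsub>V\<^esub> a \<odot>\<^bsub>V\<^esub> Y"
      by (simp add: z y smult_V add_V distrib_left)
  qed
qed

text \<open>The trace on a quotient is the trace on \<open>Z\<close> minus the trace on
  \<open>W\<close>. Composing \<open>U\<close> with the projections \<open>P\<close> onto
  \<open>Z\<close> and \<open>Q\<close> onto \<open>W\<close> expresses both as traces on
  \<open>supported_on I\<close>, so no bases of \<open>Z\<close> and \<open>W\<close> are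
  needed.\<close>

lemma lin_trace_induced_map:
  assumes I: "finite I" and ZI: "Z \<subseteq> supported_on I"
    and lin: "fun_linear U" "fun_linear P" "fun_linear Q"
    and U: "\<And>F. F \<in> supported_on I \<Longrightarrow> U F \<in> supported_on I"
      "\<And>z. z \<in> Z \<Longrightarrow> U z \<in> Z" "\<And>w. w \<in> W \<Longrightarrow> U w \<in> W"
    and P: "\<And>F. F \<in> supported_on I \<Longrightarrow> P F \<in> Z" "\<And>z. z \<in> Z \<Longrightarrow> P z = z"
    and Q: "\<And>F. F \<in> supported_on I \<Longrightarrow> Q F \<in> W" "\<And>w. w \<in> W \<Longrightarrow> Q w = w"
  shows "lin_trace V (induced_map (fun_module Z) W U)
    = fun_trace I (\<lambda>F. U (P F)) - fun_trace I (\<lambda>F. U (Q F))"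
proof -
  interpret vectorspace real_field V by (rule vectorspace_V)
  \<comment> \<open>The frame consists of the classes \<open>v i\<close>, with the coordinates of \<open>z - Q z\<close> as functionals.\<close>
  define rep where "rep X = (SOME z. z \<in> Z \<and> X = fun_coset W z)" for X
  define \<phi> where "\<phi> i X = rep X i - Q (rep X) i" for i X
  define v where "v i = fun_coset W (P (point_fun i))" for i
  \<comment> \<open>Two representatives differ by an element of \<open>W\<close>, which
    \<open>Q\<close> fixes; hence \<open>z - Q z\<close> depends on the class alone.\<close>
  have \<phi>: "\<phi> i (fun_coset W z) = z i - Q z i" if "z \<in> Z" for i z
  proof -
    have "\<exists>z'. z' \<in> Z \<and> fun_coset W z = fun_coset W z'" using that by blast
    then have "fun_coset W z = fun_coset W (rep (fun_coset W z))"
      unfolding rep_def by (rule someI2_ex) auto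
    then have "(\<lambda>x. z x - rep (fun_coset W z) x) \<in> W" by (simp add: fun_coset_eq_iff)
    from fun_cong[OF Q(2)[OF this], of i]
    have "Q z i - Q (rep (fun_coset W z)) i = z i - rep (fun_coset W z) i"
      by (simp add: fun_linear_diff[OF lin(3)])
    then show ?thesis by (simp add: \<phi>_def)
  qed
  have ptI: "point_fun i \<in> supported_on I" if "i \<in> I" for i
    using that by (rule point_fun_supported)
  have v: "v i \<in> carrier V" if "i \<in> I" for i
    using P(1)[OF ptI[OF that]] by (simp add: v_def carrier_V)
  have "fin_dim"
  proof -
    have sub: "LinearCombinations.submodule real_field (span (v ` I)) V"
      using v by (intro span_is_submodule) auto
    \<comment> \<open>As \<open>P\<close> is the identity on \<open>Z\<close>, every class has the
      form \<open>fun_coset W (P F)\<close>; expanding \<open>F\<close> in point functions then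
      shows that the finitely many \<open>v i\<close> span.\<close>
    have "fun_coset W (P F) \<in> span (v ` I)" if "F \<in> supported_on I" for F
      using I that
    proof (induction rule: supported_on_induct)
      case zero
      then show ?case
        using submodule.zero_closed[OF sub] by (simp add: fun_linear_zero[OF lin(2)] zero_V)
    next
      case (step F c i)
      have "v i \<in> span (v ` I)" using in_own_span[of "v ` I"] v step by auto
      then have "c \<odot>\<^bsub>V\<^esub> v i \<in> span (v ` I)" using submodule.smult_closed[OF sub] by simp
      then have "fun_coset W (P F) \<oplus>\<^bsub>V\<^esub> (c \<odot>\<^bsub>V\<^esub> v i) \<in> span (v ` I)"
        using submodule.m_closed[OF sub] step by simp
      then show ?case
        by (simp add: v_def smult_V add_V fun_linear_add[OF lin(2)] fun_linear_scale[OF lin(2)])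
    qed
    then have "carrier V \<subseteq> span (v ` I)" using ZI P(2) by (fastforce simp: carrier_V)
    moreover have "span (v ` I) \<subseteq> carrier V" using v by (intro span_is_subset2) auto
    ultimately show ?thesis unfolding fin_dim_def using I v by blast
  qed
  moreover have "functional_on V (\<phi> i)" for i
    unfolding functional_on_def carrier_V
    using fun_subspace_add[OF subspace_Z] fun_subspace_scale[OF subspace_Z]
    by (auto simp: add_V smult_V \<phi> fun_linear_add[OF lin(3)] fun_linear_scale[OF lin(3)] algebra_simps)
  moreover have "\<psi> X = (\<Sum>i\<in>I. \<phi> i X * \<psi> (v i))" if \<psi>: "functional_on V \<psi>" and X: "X \<in> carrier V" for \<psi> X
  proof -
    obtain z where z: "X = fun_coset W z" "z \<in> Z" using X by (auto simp: carrier_V)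
    \<comment> \<open>This representative of the class of \<open>z\<close> has as its values
      precisely the frame coordinates \<open>\<phi> i X\<close>.\<close>
    let ?y = "\<lambda>x. z x - Q z x"
    have "Q z \<in> W" using Q(1) z ZI by blast
    then have y: "?y \<in> Z" using fun_subspace_diff[OF subspace_Z z(2)] W_subset_Z by blast
    have "X = fun_coset W ?y" using \<open>Q z \<in> W\<close> by (simp add: z fun_coset_eq_iff)
    then have "X = fun_coset W (P ?y)" using P(2)[OF y] by simp
    also have "\<psi> \<dots> = (\<Sum>i\<in>I. ?y i * \<psi> (v i))"
      unfolding v_def using I
    proof (rule functional_expansion[where L = "\<lambda>F. \<psi> (fun_coset W (P F))"])
      show "?y \<in> supported_on I" using y ZI by blast
      fix F H :: "'b \<Rightarrow> real" and c
      assume F: "F \<in> supported_on I"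
      have "\<psi> (c \<odot>\<^bsub>V\<^esub> fun_coset W (P F)) = c * \<psi> (fun_coset W (P F))"
        using \<psi> P(1)[OF F] unfolding functional_on_def carrier_V by blast
      then show "\<psi> (fun_coset W (P (\<lambda>x. c * F x))) = c * \<psi> (fun_coset W (P F))"
        by (simp add: smult_V fun_linear_scale[OF lin(2)])
      assume H: "H \<in> supported_on I"
      have "\<psi> (fun_coset W (P F) \<oplus>\<^bsub>V\<^esub> fun_coset W (P H)) = \<psi> (fun_coset W (P F)) + \<psi> (fun_coset W (P H))"
        using \<psi> P(1)[OF F] P(1)[OF H] unfolding functional_on_def carrier_V by blast
      then show "\<psi> (fun_coset W (P (\<lambda>x. F x + H x))) = \<psi> (fun_coset W (P F)) + \<psi> (fun_coset W (P H))"
        by (simp add: add_V fun_linear_add[OF lin(2)])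
    qed
    also have "(\<Sum>i\<in>I. ?y i * \<psi> (v i)) = (\<Sum>i\<in>I. \<phi> i X * \<psi> (v i))"
      using z by (simp add: \<phi>)
    finally show ?thesis .
  qed
  ultimately have "lin_trace V (induced_map (fun_module Z) W U)
      = (\<Sum>i\<in>I. \<phi> i (induced_map (fun_module Z) W U (v i)))"
    using v
  proof (intro lin_trace_frame[OF vectorspace_V _ I])
    fix x y c assume "x \<in> carrier V" "y \<in> carrier V"
    then show "induced_map (fun_module Z) W U x \<in> carrier V"
      "induced_map (fun_module Z) W U (x \<oplus>\<^bsub>V\<^esub> y)
        = induced_map (fun_module Z) W U x \<oplus>\<^bsub>V\<^esub> induced_map (fun_module Z) W U y"
      "induced_map (fun_module Z) W U (c \<odot>\<^bsub>V\<^esub> x) = c \<odot>\<^bsub>V\<^esub> induced_map (fun_module Z) W U x"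
      using U by (auto simp: carrier_V induced_map_fun_coset[OF lin(1)] add_V smult_V
          fun_linear_add[OF lin(1)] fun_linear_scale[OF lin(1)])
  qed auto
  also have "\<dots> = (\<Sum>i\<in>I. U (P (point_fun i)) i - Q (U (P (point_fun i))) i)"
    using P(1) U ptI by (intro sum.cong) (auto simp: v_def induced_map_fun_coset[OF lin(1)] \<phi>)
  finally have "lin_trace V (induced_map (fun_module Z) W U)
      = fun_trace I (\<lambda>F. U (P F)) - fun_trace I (\<lambda>F. Q (U (P F)))"
    by (simp add: fun_trace_def sum_subtractf)
  moreover have "fun_trace I (\<lambda>F. Q (U (P F))) = fun_trace I (\<lambda>F. U (P (Q F)))"
  proof (rule fun_trace_commute[OF I I lin(3) fun_linear_comp[OF lin(1,2)]])
    fix i assume i: "i \<in> I"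
    show "U (P (point_fun i)) \<in> supported_on I"
      using U(1) P(1)[OF ptI[OF i]] ZI by (meson subsetD)
    show "Q (point_fun i) \<in> supported_on I"
      using Q(1)[OF ptI[OF i]] W_subset_Z ZI by (meson subsetD)
  qed
  moreover have "fun_trace I (\<lambda>F. U (P (Q F))) = fun_trace I (\<lambda>F. U (Q F))"
    unfolding fun_trace_def using P(2) Q(1) W_subset_Z ptI by (intro sum.cong) (auto simp: subset_iff)
  ultimately show ?thesis by simp
qed

end

section \<open>The Hopf trace formula\<close>

text \<open>Each inner \<open>a p\<close> arises in degrees \<open>p\<close> and
  \<open>p - 1\<close> with opposite signs; only the two ends survive.\<close>

lemma alternating_telescope:
  fixes a t :: "nat \<Rightarrow> real"
  shows "(\<Sum>p<N. (- 1) ^ p * (t p - a (Suc p) - a p)) = (\<Sum>p<N. (- 1) ^ p * t p) + (- 1) ^ N * a N - a 0"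
  by (induction N) (auto simp: algebra_simps)

text \<open>One \<open>d\<close> and one \<open>U\<close> act on all functions; the grading enters
  only through the supports \<open>I p\<close>, which avoids families of maps indexed by the
  degree.\<close>

theorem hopf_trace:
  fixes I :: "nat \<Rightarrow> 'b set" and d U :: "('b \<Rightarrow> real) \<Rightarrow> 'b \<Rightarrow> real"
    and Z B :: "nat \<Rightarrow> ('b \<Rightarrow> real) set"
  assumes fin: "\<And>p. finite (I p)" and N: "\<And>p. p \<ge> N \<Longrightarrow> I p = {}"
    and lin: "fun_linear d" "fun_linear U"
    and d: "\<And>p F. F \<in> supported_on (I p) \<Longrightarrow> d F \<in> supported_on (I (Suc p))"
    and dd: "\<And>p F. F \<in> supported_on (I p) \<Longrightarrow> d (d F) = (\<lambda>x. 0)"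
    and U: "\<And>p F. F \<in> supported_on (I p) \<Longrightarrow> U F \<in> supported_on (I p)"
    and Ud: "\<And>p F. F \<in> supported_on (I p) \<Longrightarrow> U (d F) = d (U F)"
    and Z: "\<And>p. Z p = {F \<in> supported_on (I p). d F = (\<lambda>x. 0)}"
    and B: "B 0 = {\<lambda>x. 0}" "\<And>p. B (Suc p) = d ` supported_on (I p)"
  shows "Sum_any (\<lambda>p. (- 1) ^ p * lin_trace (quotient_module (fun_module (Z p)) (B p))
            (induced_map (fun_module (Z p)) (B p) U))
    = (\<Sum>p<N. (- 1) ^ p * fun_trace (I p) U)"
proof -
  have "\<exists>s. \<forall>p. fun_linear (s p) \<and> range (s p) \<subseteq> supported_on (I p) \<and>
      (\<forall>F\<in>supported_on (I p). d (s p (d F)) = d F)"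
    using generalized_inverse[OF fin lin(1)] by (intro choice) blast
  then obtain s where s: "\<And>p. fun_linear (s p)" "\<And>p F. s p F \<in> supported_on (I p)"
      "\<And>p F. F \<in> supported_on (I p) \<Longrightarrow> d (s p (d F)) = d F"
    by blast
  \<comment> \<open>\<open>Q p\<close> projects onto the coboundaries \<open>B p\<close>; in degree
    zero there are none but zero, whence the separate case.\<close>
  define Q where "Q p = (case p of 0 \<Rightarrow> \<lambda>F x. 0 | Suc q \<Rightarrow> \<lambda>F. d (s q F))" for p
  have Q_simps: "Q 0 = (\<lambda>F x. 0)" "\<And>q. Q (Suc q) = (\<lambda>F. d (s q F))"
    by (auto simp: Q_def)
  \<comment> \<open>The trace of \<open>U\<close> on the coboundaries of degree \<open>p\<close>,
    the quantity that will telescope.\<close>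
  define a where "a p = fun_trace (I p) (\<lambda>F. U (Q p F))" for p
  have tr: "lin_trace (quotient_module (fun_module (Z p)) (B p)) (induced_map (fun_module (Z p)) (B p) U)
      = fun_trace (I p) U - a (Suc p) - a p" for p
  proof -
    define P where "P F = (\<lambda>x. F x - s p (d F) x)" for F
    have linP: "fun_linear P"
      by (auto simp: fun_linear_def P_def fun_linear_add[OF lin(1)] fun_linear_scale[OF lin(1)]
          fun_linear_add[OF s(1)] fun_linear_scale[OF s(1)] algebra_simps)
    have linQ: "fun_linear (Q p)"
      using fun_linear_comp[OF lin(1) s(1)] by (cases p) (auto simp: Q_simps fun_linear_def)
    have subZ: "fun_subspace (Z p)"
      using fun_subspace_supported_on[of "I p"]
      by (auto simp: fun_subspace_def Z fun_linear_zero[OF lin(1)] fun_linear_add[OF lin(1)]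
          fun_linear_scale[OF lin(1)])
    have subB: "fun_subspace (B p)"
      using fun_subspace_image[OF lin(1) fun_subspace_supported_on]
      by (cases p) (auto simp: B fun_subspace_def)
    have BZ: "B p \<subseteq> Z p"
      using d dd fun_subspace_zero[OF subZ] by (cases p) (auto simp: B Z)
    interpret fun_quotient "Z p" "B p" by unfold_locales (fact subZ subB BZ)+
    have "lin_trace V (induced_map (fun_module (Z p)) (B p) U)
        = fun_trace (I p) (\<lambda>F. U (P F)) - fun_trace (I p) (\<lambda>F. U (Q p F))"
    proof (rule lin_trace_induced_map[OF fin _ lin(2) linP linQ U])
      show "Z p \<subseteq> supported_on (I p)" by (auto simp: Z)
      show "U z \<in> Z p" if "z \<in> Z p" for z
        using that U Ud[of z p] fun_linear_zero[OF lin(2)] by (auto simp: Z)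
      show "U w \<in> B p" if "w \<in> B p" for w
        using that U Ud fun_linear_zero[OF lin(2)] by (cases p) (auto simp: B)
      show "P F \<in> Z p" if F: "F \<in> supported_on (I p)" for F
        using fun_subspace_diff[OF fun_subspace_supported_on F s(2)] s(3)[OF F]
        by (simp add: Z P_def fun_linear_diff[OF lin(1)])
      show "P z = z" if "z \<in> Z p" for z
        using that fun_linear_zero[OF s(1)] by (simp add: P_def Z)
      show "Q p F \<in> B p" for F
        using s(2) by (cases p) (auto simp: Q_simps B)
      show "Q p w = w" if "w \<in> B p" for w
        using that s(3) by (cases p) (auto simp: Q_simps B)
    qed
    moreover have "fun_trace (I p) (\<lambda>F. U (P F)) = fun_trace (I p) U - fun_trace (I p) (\<lambda>F. U (s p (d F)))"
      by (simp add: fun_trace_def P_def fun_linear_diff[OF lin(2)] sum_subtractf)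
    \<comment> \<open>Cyclicity with \<open>d\<close> going up and \<open>U s\<close> going down
      moves the trace to degree \<open>Suc p\<close>. There \<open>d U\<close> may be replaced by
      \<open>U d\<close>, because \<open>s p\<close> takes values in
      \<open>supported_on (I p)\<close>.\<close>
    moreover have "fun_trace (I p) (\<lambda>F. U (s p (d F))) = fun_trace (I (Suc p)) (\<lambda>F. d (U (s p F)))"
      using d[OF point_fun_supported] U[OF s(2)]
      by (rule fun_trace_commute[OF fin fin fun_linear_comp[OF lin(2) s(1)] lin(1)])
    moreover have "fun_trace (I (Suc p)) (\<lambda>F. d (U (s p F))) = a (Suc p)"
      by (simp add: a_def Q_simps Ud[OF s(2)])
    ultimately show ?thesis by (simp add: a_def)
  qed
  have zero: "fun_trace (I p) U - a (Suc p) - a p = 0" if "p \<ge> N" for p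
    using that N[of p] N[of "Suc p"] by (simp add: fun_trace_def a_def)
  \<comment> \<open>The lower end vanishes since \<open>Q 0\<close> is zero, the upper one since
    \<open>I N\<close> is empty.\<close>
  have a_ends: "a 0 = 0" "a N = 0"
    using N[of N] by (auto simp: a_def fun_trace_def Q_simps fun_linear_zero[OF lin(2)])
  have "Sum_any (\<lambda>p. (- 1) ^ p * (fun_trace (I p) U - a (Suc p) - a p))
      = (\<Sum>p<N. (- 1) ^ p * (fun_trace (I p) U - a (Suc p) - a p))"
    using zero by (intro Sum_any.expand_superset) (auto simp: not_less[symmetric])
  also have "\<dots> = (\<Sum>p<N. (- 1) ^ p * fun_trace (I p) U)"
    using alternating_telescope[of "\<lambda>p. fun_trace (I p) U" a N] a_ends by simp
  finally show ?thesis by (simp add: tr)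
qed

section \<open>Orientation signs\<close>

text \<open>Equal labels get the value -1 and not 0, so that the square is one without side
  conditions.\<close>

definition order_sign :: "('a \<Rightarrow> nat) \<Rightarrow> 'a \<Rightarrow> 'a \<Rightarrow> real" where
  "order_sign h v w = (if h v < h w then 1 else - 1)"

text \<open>The parity of the number of inversions with respect to the labelling \<open>h\<close>.\<close>
primrec list_sign :: "('a \<Rightarrow> nat) \<Rightarrow> 'a list \<Rightarrow> real" where
  "list_sign h [] = 1"
| "list_sign h (v # vs) = (\<Prod>w\<leftarrow>vs. order_sign h v w) * list_sign h vs"

text \<open>For \<open>h\<close> injective on a finite \<open>x\<close> containing \<open>v\<close>,
  this is \<open>(-1)^i\<close> with \<open>i\<close> the position of \<open>v\<close>, counted from
  zero, in the order of \<open>x\<close> by increasing label: the boundary sign in that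
  orientation.\<close>

definition vertex_sign :: "('a \<Rightarrow> nat) \<Rightarrow> 'a set \<Rightarrow> 'a \<Rightarrow> real" where
  "vertex_sign h x v = (\<Prod>w\<in>x - {v}. order_sign h v w)"

lemma order_sign_swap: "h v \<noteq> h w \<Longrightarrow> order_sign h w v = - order_sign h v w"
  by (auto simp: order_sign_def)

lemma order_sign_square: "order_sign h v w * order_sign h v w = 1"
  by (auto simp: order_sign_def)

lemma prod_list_square:
  fixes f :: "'c \<Rightarrow> real"
  assumes "\<And>x. f x * f x = 1" shows "prod_list (map f xs) * prod_list (map f xs) = 1"
proof (induction xs)
  case (Cons x xs)
  have "prod_list (map f (x # xs)) * prod_list (map f (x # xs))
      = (f x * f x) * (prod_list (map f xs) * prod_list (map f xs))" by simp
  then show ?case using Cons assms[of x] by simp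
qed simp

lemma prod_list_map_mult:
  fixes f g :: "'c \<Rightarrow> real"
  shows "(\<Prod>x\<leftarrow>xs. f x * g x) = prod_list (map f xs) * prod_list (map g xs)"
  by (induction xs) auto

lemma list_sign_square: "list_sign h vs * list_sign h vs = 1"
proof (induction vs)
  case (Cons v vs)
  have "list_sign h (v # vs) * list_sign h (v # vs)
      = ((\<Prod>w\<leftarrow>vs. order_sign h v w) * (\<Prod>w\<leftarrow>vs. order_sign h v w)) * (list_sign h vs * list_sign h vs)"
    by (simp add: mult_ac)
  also have "\<dots> = 1"
    using prod_list_square[of "order_sign h v" vs, OF order_sign_square] Cons by simp
  finally show ?case .
qed simp

lemma list_sign_append:
  "list_sign h (us @ vs) = list_sign h us * list_sign h vs * (\<Prod>u\<leftarrow>us. \<Prod>w\<leftarrow>vs. order_sign h u w)"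
  by (induction us) (auto simp: algebra_simps)

lemma prod_list_order_sign_swap:
  assumes "\<And>w. w \<in> set vs \<Longrightarrow> h v \<noteq> h w"
  shows "(\<Prod>w\<leftarrow>vs. order_sign h w v) = (- 1) ^ length vs * (\<Prod>w\<leftarrow>vs. order_sign h v w)"
  using assms by (induction vs) (auto simp: order_sign_swap[of h v])

text \<open>The exchange reverses the comparisons of both \<open>a\<close> and \<open>b\<close> with
  each entry of \<open>vs\<close>, an even number, and in addition the one between \<open>a\<close>
  and \<open>b\<close>.\<close>

lemma list_sign_exchange:
  assumes "distinct (us @ a # vs @ b # ws)" "inj_on h (set (us @ a # vs @ b # ws))"
  shows "list_sign h (us @ b # vs @ a # ws) = - list_sign h (us @ a # vs @ b # ws)"
proof -
  have "a \<noteq> b" "a \<notin> set vs" "b \<notin> set vs" using assms(1) by auto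
  then have ab: "h a \<noteq> h b" and va: "\<And>w. w \<in> set vs \<Longrightarrow> h a \<noteq> h w" and vb: "\<And>w. w \<in> set vs \<Longrightarrow> h b \<noteq> h w"
    using assms(2) by (auto simp: inj_on_def)
  have "(\<Prod>w\<leftarrow>vs. order_sign h w a) = (- 1) ^ length vs * (\<Prod>w\<leftarrow>vs. order_sign h a w)"
    "(\<Prod>w\<leftarrow>vs. order_sign h w b) = (- 1) ^ length vs * (\<Prod>w\<leftarrow>vs. order_sign h b w)"
    using prod_list_order_sign_swap[of vs h a] prod_list_order_sign_swap[of vs h b] va vb by auto
  then show ?thesis
    by (simp add: list_sign_append prod_list_map_mult order_sign_swap[of h a b, OF ab])
qed

lemma list_sign_transpose:
  assumes "distinct vs" "inj_on h (set vs)" "a \<in> set vs" "b \<in> set vs" "a \<noteq> b"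
  shows "list_sign h (map (Transposition.transpose a b) vs) = - list_sign h vs"
proof -
  have unmoved: "map (Transposition.transpose a b) us = us" if "a \<notin> set us" "b \<notin> set us" for us
    using that by (intro map_idI) (auto simp: transpose_def)
  obtain us ws where vs: "vs = us @ a # ws" using split_list[OF assms(3)] by blast
  then consider "b \<in> set ws" | "b \<in> set us" using assms(4,5) by auto
  then show ?thesis
  proof cases
    case 1
    then obtain ws1 ws2 where ws: "ws = ws1 @ b # ws2" using split_list by fast
    show ?thesis
      using assms list_sign_exchange[of us a ws1 b ws2 h] unmoved[of us] unmoved[of ws1] unmoved[of ws2]
      by (simp add: vs ws)
  next
    case 2
    then obtain us1 us2 where us: "us = us1 @ b # us2" using split_list by fast
    show ?thesis
      using assms list_sign_exchange[of us1 b us2 a ws h] unmoved[of us1] unmoved[of us2] unmoved[of ws]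
      by (simp add: vs us)
  qed
qed

text \<open>Induction over transpositions composed on the left: they act on \<open>map p vs\<close>,
  which lists the same vertices, and each flips both signs.\<close>

lemma list_sign_map_permutes:
  assumes "p permutes set vs" "distinct vs" "inj_on h (set vs)"
  shows "list_sign h (map p vs) = of_int (sign p) * list_sign h vs"
  using assms(1) finite_set
proof (induction rule: permutes_induct)
  case id
  then show ?case by (simp add: sign_id)
next
  case (swap a b p)
  have us: "distinct (map p vs)" "set (map p vs) = set vs"
    using swap.hyps assms(2) permutes_inj_on[of p "set vs"] permutes_image[of p "set vs"]
    by (auto simp: distinct_map)
  have "list_sign h (map (Transposition.transpose a b \<circ> p) vs)
      = list_sign h (map (Transposition.transpose a b) (map p vs))" by simp
  also have "\<dots> = - list_sign h (map p vs)"
    using us assms(3) swap by (intro list_sign_transpose) auto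
  also have "\<dots> = - (of_int (sign p) * list_sign h vs)"
    using swap by simp
  also have "\<dots> = of_int (sign (Transposition.transpose a b \<circ> p)) * list_sign h vs"
  proof -
    have "permutation p" using swap.hyps permutation_permutes by blast
    then have "sign (Transposition.transpose a b \<circ> p) = - sign p"
      using swap.hyps by (subst sign_compose) (auto simp: sign_swap_id permutation_swap_id)
    then show ?thesis by simp
  qed
  finally show ?case .
qed

section \<open>The sign between two orderings as a product of inversion parities\<close>

lemma ex_permutes_map:
  assumes "distinct vs" "distinct ws" "set vs = set ws"
  shows "\<exists>p. p permutes set vs \<and> map p vs = ws"
proof -
  define p where "p x = (case map_of (zip vs ws) x of Some y \<Rightarrow> y | None \<Rightarrow> x)" for x
  have len: "length vs = length ws"
    using assms by (metis distinct_card)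
  have "p (vs ! i) = ws ! i" if "i < length vs" for i
    using assms(1) len that by (simp add: p_def map_of_zip_nth)
  then have m: "map p vs = ws"
    using len by (intro nth_equalityI) auto
  have "bij_betw p (set vs) (set vs)"
    using m assms by (metis bij_betw_def distinct_map set_map)
  moreover have "p x = x" if "x \<notin> set vs" for x
    using that len by (auto simp: p_def split: option.split dest: map_of_SomeD set_zip_leftD)
  ultimately have "p permutes set vs" by (intro bij_imp_permutes) auto
  then show ?thesis using m by blast
qed

lemma orient_sign_permutes:
  assumes "p permutes set vs" "map p vs = ws" shows "orient_sign vs ws = sign p"
proof -
  have "q = p" if "q permutes set vs" "map q vs = ws" for q
  proof
    fix x show "q x = p x"
      using that assms by (cases "x \<in> set vs") (auto simp: permutes_not_in)
  qed
  then have "(THE q. q permutes set vs \<and> map q vs = ws) = p"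
    using assms by (intro the_equality) blast+
  then show ?thesis by (simp add: orient_sign_def)
qed

lemma orient_sign_eq_list_sign:
  assumes "distinct vs" "distinct ws" "set vs = set ws" "inj_on h (set vs)"
  shows "of_int (orient_sign vs ws) = list_sign h vs * list_sign h ws"
proof -
  obtain p where p: "p permutes set vs" "map p vs = ws"
    using ex_permutes_map[OF assms(1-3)] by blast
  have "list_sign h vs * list_sign h ws = of_int (sign p) * (list_sign h vs * list_sign h vs)"
    using list_sign_map_permutes[OF p(1) assms(1,4)] p(2) by simp
  then show ?thesis using list_sign_square[of h vs] orient_sign_permutes[OF p] by simp
qed

lemma orient_sign_self: "orient_sign vs vs = 1"
  using orient_sign_permutes[of id vs vs] permutes_id by (auto simp: sign_id)

text \<open>Moving the vertex at position \<open>i\<close> to the front costs \<open>(-1)^i\<close>;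
  dropping it from there costs its comparisons with all other vertices, which is
  \<open>vertex_sign\<close>.\<close>

lemma list_sign_delete:
  assumes "i < length vs" "distinct vs" "inj_on h (set vs)"
  shows "(- 1) ^ i * list_sign h (take i vs @ drop (Suc i) vs) = list_sign h vs * vertex_sign h (set vs) (vs ! i)"
proof -
  define us where "us = take i vs"
  define v where "v = vs ! i"
  define ws where "ws = drop (Suc i) vs"
  have vs: "vs = us @ v # ws" and i: "length us = i"
    using assms(1) id_take_nth_drop[of i vs] by (auto simp: us_def v_def ws_def)
  have d: "distinct (us @ v # ws)" using assms(2) vs by simp
  have "vertex_sign h (set vs) v = (\<Prod>w\<leftarrow>us @ ws. order_sign h v w)"
    unfolding vertex_sign_def using d
    by (subst prod.distinct_set_conv_list[symmetric]) (auto simp: vs intro!: prod.cong)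
  then have \<eta>: "vertex_sign h (set vs) v = (\<Prod>w\<leftarrow>us. order_sign h v w) * (\<Prod>w\<leftarrow>ws. order_sign h v w)"
    by simp
  have "h v \<noteq> h w" if "w \<in> set us" for w
    using that d assms(3) vs by (auto simp: inj_on_def)
  from prod_list_order_sign_swap[of us h v, OF this]
  have sw: "(\<Prod>w\<leftarrow>us. order_sign h w v) = (- 1) ^ i * (\<Prod>w\<leftarrow>us. order_sign h v w)" by (simp add: i)
  let ?a = "\<Prod>w\<leftarrow>us. order_sign h v w" and ?b = "\<Prod>w\<leftarrow>ws. order_sign h v w"
  have "list_sign h vs * vertex_sign h (set vs) v
      = (- 1) ^ i * list_sign h (us @ ws) * (?a * ?a) * (?b * ?b)"
    by (simp add: \<eta>) (simp add: vs list_sign_append prod_list_map_mult sw algebra_simps)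
  also have "\<dots> = (- 1) ^ i * list_sign h (us @ ws)"
    using prod_list_square[of "order_sign h v"] order_sign_square[of h v] by simp
  finally show ?thesis by (simp add: us_def v_def ws_def)
qed

text \<open>The factor \<open>list_sign\<close> carried by \<open>f\<close> absorbs the alternating
  sign, so the sum over positions becomes a sum over vertices that no longer refers to
  positions.\<close>

lemma sum_list_boundary:
  fixes f :: "'a list \<Rightarrow> real"
  assumes "distinct vs" "inj_on h (set vs)" "length vs \<ge> 2"
    and f: "\<And>i. i < length vs \<Longrightarrow>
      f (take i vs @ drop (Suc i) vs) = list_sign h (take i vs @ drop (Suc i) vs) * g (vs ! i)"
  shows "(\<Sum>(c, ws)\<leftarrow>boundary vs. c * f ws) = (\<Sum>v\<in>set vs. list_sign h vs * vertex_sign h (set vs) v * g v)"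
proof -
  have "(\<Sum>(c, ws)\<leftarrow>boundary vs. c * f ws) = (\<Sum>i<length vs. (- 1) ^ i * f (take i vs @ drop (Suc i) vs))"
    using assms(3) by (simp add: boundary_def o_def interv_sum_list_conv_sum_set_nat atLeast0LessThan)
  also have "\<dots> = (\<Sum>i<length vs. list_sign h vs * vertex_sign h (set vs) (vs ! i) * g (vs ! i))"
    using list_sign_delete[OF _ assms(1,2)] f
    by (intro sum.cong) (auto simp: mult.assoc[symmetric])
  also have "\<dots> = (\<Sum>v\<in>set vs. list_sign h vs * vertex_sign h (set vs) v * g v)"
    using assms(1) by (intro sum.reindex_bij_betw bij_betw_nth) auto
  finally show ?thesis .
qed

section \<open>The exterior derivative\<close>

text \<open>For simplices \<open>x\<close> and \<open>x - {v}\<close> this is the incidence number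
  of the face in the boundary of \<open>x\<close>, both with their chosen orientations.\<close>

definition face_coeff :: "('a \<Rightarrow> nat) \<Rightarrow> ('a set \<Rightarrow> 'a list) \<Rightarrow> 'a set \<Rightarrow> 'a \<Rightarrow> real" where
  "face_coeff h ori x v = list_sign h (ori x) * vertex_sign h x v * list_sign h (ori (x - {v}))"

definition degree_sign :: "'a set list \<Rightarrow> nat \<Rightarrow> real" where
  "degree_sign xs j = (- 1) ^ (\<Sum>i<j. sdim (xs ! i))"

text \<open>A flag marks one vertex in one entry of a tuple; \<open>face\<close> deletes the marked vertex.\<close>

definition flags :: "'a set list \<Rightarrow> (nat \<times> 'a) set" where
  "flags xs = Sigma {..<length xs} (\<lambda>j. xs ! j)"

definition face :: "'a set list \<Rightarrow> nat \<times> 'a \<Rightarrow> 'a set list" where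
  "face xs e = xs[fst e := xs ! fst e - {snd e}]"

definition flag_coeff :: "('a \<Rightarrow> nat) \<Rightarrow> ('a set \<Rightarrow> 'a list) \<Rightarrow> 'a set list \<Rightarrow> nat \<times> 'a \<Rightarrow> real" where
  "flag_coeff h ori xs e = degree_sign xs (fst e) * face_coeff h ori (xs ! fst e) (snd e)"

lemma length_face [simp]: "length (face xs e) = length xs"
  by (simp add: face_def)

lemma face_nth: "i < length xs \<Longrightarrow> face xs e ! i = (if i = fst e then xs ! i - {snd e} else xs ! i)"
  by (auto simp: face_def nth_list_update)

lemma flags_face: "e \<in> flags xs \<Longrightarrow> flags (face xs e) = flags xs - {e}"
  by (cases e) (auto simp: flags_def face_nth split: if_splits)

lemma face_face_commute: "face (face xs e) e' = face (face xs e') e"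
  by (rule nth_equalityI) (auto simp: face_nth)

lemma sum_antisymmetric:
  fixes t :: "'e \<Rightarrow> 'e \<Rightarrow> real"
  assumes "finite E" and t: "\<And>e e'. e \<in> E \<Longrightarrow> e' \<in> E \<Longrightarrow> e \<noteq> e' \<Longrightarrow> t e e' = - t e' e"
  shows "(\<Sum>e\<in>E. \<Sum>e'\<in>E - {e}. t e e') = 0"
proof -
  \<comment> \<open>With the diagonal set to zero the double sum runs over a full square, where
    exchanging the summations turns it into its negative.\<close>
  let ?t = "\<lambda>e e'. if e = e' then 0 else t e e'"
  have eq: "(\<Sum>e'\<in>E - {e}. t e e') = (\<Sum>e'\<in>E. ?t e e')" for e
    using assms(1) by (intro sum.mono_neutral_cong_left) auto
  have "(\<Sum>e\<in>E. \<Sum>e'\<in>E. ?t e e') = (\<Sum>e\<in>E. \<Sum>e'\<in>E. ?t e' e)"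
    by (rule sum.swap)
  also have "\<dots> = (\<Sum>e\<in>E. \<Sum>e'\<in>E. - ?t e e')"
  proof (intro sum.cong refl)
    fix e e' assume "e \<in> E" "e' \<in> E"
    then show "?t e' e = - ?t e e'" using t[of e' e] by (cases "e = e'") simp_all
  qed
  also have "\<dots> = - (\<Sum>e\<in>E. \<Sum>e'\<in>E. ?t e e')"
    by (simp add: sum_negf)
  finally show ?thesis by (simp add: eq)
qed

lemma vertex_sign_remove:
  assumes "finite x" "w \<in> x" "w \<noteq> v"
  shows "vertex_sign h x v = order_sign h v w * vertex_sign h (x - {w}) v"
proof -
  have "x - {v} = insert w (x - {w} - {v})" using assms by auto
  then show ?thesis using assms(1) by (simp add: vertex_sign_def)
qed

text \<open>Either order of deletion leaves the same list signs. The vertex signs differ only by the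
  comparison of \<open>v\<close> with \<open>w\<close> in place of that of \<open>w\<close> with
  \<open>v\<close>, and these are opposite.\<close>

lemma face_coeff_anticommute:
  assumes "finite x" "inj_on h x" "v \<in> x" "w \<in> x" "v \<noteq> w"
  shows "face_coeff h ori x v * face_coeff h ori (x - {v}) w
    = - (face_coeff h ori x w * face_coeff h ori (x - {w}) v)"
proof -
  have sw: "order_sign h w v = - order_sign h v w"
    using assms by (intro order_sign_swap) (auto simp: inj_on_def)
  have c: "x - {w} - {v} = x - {v} - {w}" by auto
  have sq: "list_sign h us * (list_sign h us * r) = r" for us r
    using list_sign_square[of h us] by (simp add: mult.assoc[symmetric])
  show ?thesis
    using vertex_sign_remove[OF assms(1,4), of v h] vertex_sign_remove[OF assms(1,3), of w h] assms(5)
    by (simp add: face_coeff_def c sw sq mult_ac)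
qed

lemma set_delete_nth:
  assumes "distinct vs" "i < length vs"
  shows "set (take i vs @ drop (Suc i) vs) = set vs - {vs ! i}" "distinct (take i vs @ drop (Suc i) vs)"
proof -
  have vs: "vs = take i vs @ vs ! i # drop (Suc i) vs" by (rule id_take_nth_drop[OF assms(2)])
  then have d: "distinct (take i vs @ vs ! i # drop (Suc i) vs)" using assms(1) by simp
  have "set vs = set (take i vs) \<union> insert (vs ! i) (set (drop (Suc i) vs))"
    using arg_cong[OF vs, of set] by simp
  then show "set (take i vs @ drop (Suc i) vs) = set vs - {vs ! i}" using d by auto
  show "distinct (take i vs @ drop (Suc i) vs)" using d by auto
qed

lemma oriented_value_linear:
  "oriented_value ori (\<lambda>x. F x + H x) vss = oriented_value ori F vss + oriented_value ori H vss"
  "oriented_value ori (\<lambda>x. c * F x) vss = c * oriented_value ori F vss"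
  by (simp_all add: oriented_value_def distrib_left)

lemma fun_linear_ext_deriv: "fun_linear (ext_deriv G k ori)"
  unfolding fun_linear_def
proof (intro conjI allI ext)
  fix F H :: "'a form" and c xs
  show "ext_deriv G k ori (\<lambda>x. F x + H x) xs = ext_deriv G k ori F xs + ext_deriv G k ori H xs"
    by (simp add: ext_deriv_def oriented_value_linear split_def distrib_left sum_list_addf sum.distrib)
  show "ext_deriv G k ori (\<lambda>x. c * F x) xs = c * ext_deriv G k ori F xs"
    by (simp add: ext_deriv_def oriented_value_linear split_def sum_list_const_mult sum_distrib_left mult.left_commute)
qed

lemma fun_linear_pullback: "fun_linear (pullback G k ori T)"
  by (auto simp: fun_linear_def pullback_def oriented_value_linear)

text \<open>The labelling \<open>h\<close> is auxiliary: \<open>d\<close> does not depend on it, and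
  it serves only to split orientation signs.\<close>

locale oriented_complex =
  fixes G :: "'a set set" and k :: nat and ori :: "'a set \<Rightarrow> 'a list" and h :: "'a \<Rightarrow> nat"
  assumes complex: "simplicial_complex G" and ori: "orientation G ori" and inj_h: "inj_on h (\<Union>G)"
begin

abbreviation "I \<equiv> interacting G k"

abbreviation "d \<equiv> ext_deriv G k ori"

lemma simplexD: "x \<in> G \<Longrightarrow> finite x" "x \<in> G \<Longrightarrow> x \<noteq> {}"
  "x \<in> G \<Longrightarrow> y \<subseteq> x \<Longrightarrow> y \<noteq> {} \<Longrightarrow> y \<in> G"
  using complex unfolding simplicial_complex_def by blast+

lemma oriD: "x \<in> G \<Longrightarrow> distinct (ori x)" "x \<in> G \<Longrightarrow> set (ori x) = x"
  using ori by (auto simp: orientation_def)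

lemma inj_on_simplex: "x \<in> G \<Longrightarrow> inj_on h x"
  using inj_h by (rule inj_on_subset) auto

section \<open>Interacting tuples and their faces\<close>

lemma interactingD:
  assumes "xs \<in> I"
  shows "length xs = k" "\<And>j. j < k \<Longrightarrow> xs ! j \<in> G" "\<And>i j. i < k \<Longrightarrow> j < k \<Longrightarrow> xs ! i \<inter> xs ! j \<noteq> {}"
  using assms by (auto simp: interacting_def subset_iff)

lemma finite_interacting: "finite I"
proof -
  have "finite G" using complex by (simp add: simplicial_complex_def)
  then show ?thesis
    by (intro finite_subset[OF _ finite_lists_length_eq[of G k]]) (auto simp: interacting_def)
qed

lemma finite_flags: "xs \<in> I \<Longrightarrow> finite (flags xs)"
  using interactingD simplexD(1) by (auto simp: flags_def)

lemma flagsD: "xs \<in> I \<Longrightarrow> e \<in> flags xs \<Longrightarrow> fst e < k \<and> snd e \<in> xs ! fst e \<and> xs ! fst e \<in> G"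
  using interactingD by (auto simp: flags_def)

text \<open>Intersections grow with the entries. The condition for equal indices makes every entry
  nonempty, and a nonempty subset of a simplex is a simplex.\<close>

lemma interacting_upward:
  assumes "length ys = k" "length zs = k" "zs \<in> I"
    and "\<And>i. i < k \<Longrightarrow> zs ! i \<subseteq> ys ! i" "\<And>i. i < k \<Longrightarrow> \<exists>x\<in>G. ys ! i \<subseteq> x"
  shows "ys \<in> I"
proof -
  have meet: "ys ! i \<inter> ys ! j \<noteq> {}" if "i < k" "j < k" for i j
    using interactingD(3)[OF assms(3) that] assms(4)[OF that(1)] assms(4)[OF that(2)] by blast
  have "ys ! i \<in> G" if "i < k" for i
    using simplexD(3) meet[OF that that] assms(5)[OF that] by blast
  then show ?thesis
    using assms(1) meet by (auto simp: interacting_def set_conv_nth)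
qed

text \<open>As \<open>sdim\<close> truncates at zero, deleting the only vertex of an entry would not
  lower it; an interacting face rules this out.\<close>

lemma card_of_interacting_face:
  assumes "xs \<in> I" "e \<in> flags xs" "face xs e \<in> I"
  shows "sdim (xs ! fst e) = Suc (sdim (xs ! fst e - {snd e}))"
proof -
  have e: "fst e < k" "snd e \<in> xs ! fst e" "xs ! fst e \<in> G" using flagsD[OF assms(1,2)] by auto
  have "face xs e ! fst e = xs ! fst e - {snd e}"
    using e(1) interactingD(1)[OF assms(1)] by (simp add: face_nth)
  then have "xs ! fst e - {snd e} \<in> G" using interactingD(2)[OF assms(3) e(1)] by simp
  then have "card (xs ! fst e - {snd e}) > 0"
    using simplexD(1,2) by (metis card_gt_0_iff)
  then show ?thesis using e simplexD(1)[OF e(3)] by (simp add: sdim_def card_Diff_singleton)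
qed

text \<open>With \<open>l = k\<close> this gives the drop in degree, with smaller \<open>l\<close>
  the sign change in front of a later entry.\<close>

lemma sum_sdim_face:
  assumes "xs \<in> I" "e \<in> flags xs" "face xs e \<in> I" "fst e < l" "l \<le> k"
  shows "(\<Sum>i<l. sdim (xs ! i)) = Suc (\<Sum>i<l. sdim (face xs e ! i))"
proof -
  have l: "length xs = k" by (rule interactingD(1)[OF assms(1)])
  have "(\<Sum>i<l. sdim (xs ! i)) = sdim (xs ! fst e) + (\<Sum>i\<in>{..<l} - {fst e}. sdim (xs ! i))"
    using assms(4) by (intro sum.remove) auto
  also have "(\<Sum>i\<in>{..<l} - {fst e}. sdim (xs ! i)) = (\<Sum>i\<in>{..<l} - {fst e}. sdim (face xs e ! i))"
    using assms(5) l by (intro sum.cong) (auto simp: face_nth)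
  also have "sdim (xs ! fst e) = Suc (sdim (face xs e ! fst e))"
    using card_of_interacting_face[OF assms(1-3)] assms(4,5) l by (simp add: face_nth)
  also have "Suc (sdim (face xs e ! fst e)) + (\<Sum>i\<in>{..<l} - {fst e}. sdim (face xs e ! i))
      = Suc (\<Sum>i<l. sdim (face xs e ! i))"
    using assms(4) sum.remove[of "{..<l}" "fst e" "\<lambda>i. sdim (face xs e ! i)"] by simp
  finally show ?thesis .
qed

lemma oriented_value_update:
  assumes "xs \<in> I" "j < k"
  shows "oriented_value ori F ((map ori xs)[j := ws]) = of_int (orient_sign (ori (set ws)) ws) * F (xs[j := set ws])"
proof -
  note D = interactingD[OF assms(1)]
  have "map set ((map ori xs)[j := ws]) = xs[j := set ws]"
    using D oriD assms(2) by (intro nth_equalityI) (auto simp: nth_list_update)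
  moreover have "(\<Prod>i<length ((map ori xs)[j := ws]).
      of_int (orient_sign (ori (set ((map ori xs)[j := ws] ! i))) ((map ori xs)[j := ws] ! i)))
      = (\<Prod>i<k. if i = j then of_int (orient_sign (ori (set ws)) ws) else 1 :: real)"
    using D oriD assms(2) by (intro prod.cong) (auto simp: nth_list_update orient_sign_self)
  ultimately show ?thesis
    using assms(2) by (simp add: oriented_value_def)
qed

text \<open>This is \<open>d\<close> as a matrix indexed by tuples and their faces. Faces that do
  not interact may stay in the sum, since \<open>F\<close> vanishes on them.\<close>

lemma ext_deriv_eq:
  assumes F: "F \<in> supported_on I" and xs: "xs \<in> I"
  shows "d F xs = (\<Sum>e\<in>flags xs. flag_coeff h ori xs e * F (face xs e))"
proof -
  note D = interactingD[OF xs]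
  have "(\<Sum>(c, vs)\<leftarrow>boundary (ori (xs ! j)). c * oriented_value ori F ((map ori xs)[j := vs]))
      = (\<Sum>v\<in>xs ! j. face_coeff h ori (xs ! j) v * F (face xs (j, v)))" (is "?l = ?r") if j: "j < k" for j
  proof -
    let ?x = "xs ! j"
    have x: "?x \<in> G" using D(2)[OF j] .
    note o = oriD[OF x] and fin = simplexD(1)[OF x]
    have len: "length (ori ?x) = card ?x" using o by (metis distinct_card)
    have "card ?x \<noteq> 0" using simplexD[OF x] by simp
    then consider "card ?x = 1" | "card ?x \<ge> 2" by linarith
    then show "?l = ?r"
    proof cases
      case 1
      then obtain u where u: "?x = {u}" by (rule card_1_singletonE)
      \<comment> \<open>A single vertex has empty boundary, whereas the right-hand side has a term
        whose tuple contains the empty set; \<open>F\<close> is zero there.\<close>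
      have "face xs (j, u) ! j = {}" using u j D(1) by (simp add: face_nth)
      then have "face xs (j, u) \<notin> I" using interactingD(3)[of _ j j] j by blast
      then have "F (face xs (j, u)) = 0" using F by (simp add: supported_on_def)
      then show ?thesis using u len by (simp add: boundary_def)
    next
      case 2
      have ih: "inj_on h (set (ori ?x))" using inj_on_simplex[OF x] o(2) by simp
      have "oriented_value ori F ((map ori xs)[j := take i (ori ?x) @ drop (Suc i) (ori ?x)])
          = list_sign h (take i (ori ?x) @ drop (Suc i) (ori ?x)) *
            (list_sign h (ori (?x - {ori ?x ! i})) * F (face xs (j, ori ?x ! i)))"
        if i: "i < length (ori ?x)" for i
      proof -
        let ?vs = "take i (ori ?x) @ drop (Suc i) (ori ?x)"
        have s: "set ?vs = ?x - {ori ?x ! i}" "distinct ?vs" using set_delete_nth[OF o(1) i] o(2) by auto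
        have "\<not> ?x \<subseteq> {ori ?x ! i}" using 2 card_mono[of "{ori ?x ! i}" ?x] by auto
        then have G: "?x - {ori ?x ! i} \<in> G" by (intro simplexD(3)[OF x]) auto
        have "real_of_int (orient_sign (ori (set ?vs)) ?vs) = list_sign h (ori (set ?vs)) * list_sign h ?vs"
          using s G oriD[OF G] inj_on_simplex[OF G] by (intro orient_sign_eq_list_sign) auto
        moreover have "xs[j := set ?vs] = face xs (j, ori ?x ! i)" by (simp only: s face_def fst_conv snd_conv)
        ultimately show ?thesis unfolding oriented_value_update[OF xs j] by (simp only: s mult_ac)
      qed
      from sum_list_boundary[where f = "\<lambda>vs. oriented_value ori F ((map ori xs)[j := vs])" and
          g = "\<lambda>v. list_sign h (ori (?x - {v})) * F (face xs (j, v))", OF o(1) ih _ this] 2 len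
      show ?thesis by (simp add: o(2) face_coeff_def mult.assoc)
    qed
  qed
  then have "d F xs = (\<Sum>j<k. \<Sum>v\<in>xs ! j. flag_coeff h ori xs (j, v) * F (face xs (j, v)))"
    using xs by (simp add: ext_deriv_def flag_coeff_def degree_sign_def sum_distrib_left mult.assoc)
  also have "\<dots> = (\<Sum>e\<in>flags xs. flag_coeff h ori xs e * F (face xs e))"
    using D simplexD(1) by (subst sum.Sigma) (auto simp: flags_def split_def)
  finally show ?thesis .
qed

lemma ext_deriv_supported: "d F \<in> supported_on I"
  by (simp add: supported_on_def ext_deriv_def)

lemma face_subsimplex:
  assumes "xs \<in> I" "i < k" shows "\<exists>x\<in>G. face xs e ! i \<subseteq> x"
  using interactingD(1,2)[OF assms(1)] assms(2) by (intro bexI[of _ "xs ! i"]) (auto simp: face_nth)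

lemma interacting_face:
  assumes "xs \<in> I" "face (face xs e) e' \<in> I" shows "face xs e \<in> I"
proof (rule interacting_upward[OF _ _ assms(2)])
  show "face (face xs e) e' ! i \<subseteq> face xs e ! i" if "i < k" for i
    using that interactingD(1)[OF assms(1)] by (auto simp: face_nth)
  show "\<exists>x\<in>G. face xs e ! i \<subseteq> x" if "i < k" for i
    by (rule face_subsimplex[OF assms(1) that])
qed (simp_all add: interactingD(1)[OF assms(1)])

text \<open>The expansion persists at faces that do not interact: \<open>d F\<close> is zero there
  by definition, and by \<open>interacting_face\<close> none of their faces interacts
  either.\<close>

lemma ext_deriv_face:
  assumes F: "F \<in> supported_on I" and xs: "xs \<in> I"
  shows "d F (face xs e) = (\<Sum>e'\<in>flags (face xs e). flag_coeff h ori (face xs e) e' * F (face (face xs e) e'))"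
proof (cases "face xs e \<in> I")
  case False
  then have "F (face (face xs e) e') = 0" for e'
    using F interacting_face[OF xs, of e e'] by (auto simp: supported_on_def)
  then show ?thesis using False by (simp add: ext_deriv_def)
qed (rule ext_deriv_eq[OF F])

text \<open>Within one entry the incidence numbers anticommute. In different entries a deletion in
  the earlier one flips the degree sign of the later one, but not conversely. The factor
  \<open>F\<close> restricts attention to interacting double faces, where every deletion lowers the
  degree.\<close>

lemma flag_coeff_antisymmetric:
  assumes F: "F \<in> supported_on I" and xs: "xs \<in> I" and e: "e \<in> flags xs" and e': "e' \<in> flags xs" and ne: "e \<noteq> e'"
  shows "flag_coeff h ori xs e * flag_coeff h ori (face xs e) e' * F (face (face xs e) e')
    = - (flag_coeff h ori xs e' * flag_coeff h ori (face xs e') e * F (face (face xs e') e))"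
proof (cases "face (face xs e) e' \<in> I")
  case False
  then have "F (face (face xs e) e') = 0" using F by (simp add: supported_on_def)
  then show ?thesis using face_face_commute[of xs e e'] by simp
next
  case True
  have l: "length xs = k" by (rule interactingD(1)[OF xs])
  have I: "face xs e \<in> I" "face xs e' \<in> I"
    using interacting_face[OF xs, of e e'] interacting_face[OF xs, of e' e] True
      face_face_commute[of xs e e'] by auto
  note f = flagsD[OF xs e] flagsD[OF xs e']
  have ds_same: "degree_sign (face xs e) j = degree_sign xs j" if "j \<le> fst e" "j < k" for e j
    using that l by (auto simp: degree_sign_def face_nth intro!: arg_cong[where f = "\<lambda>n. (- 1) ^ n"] sum.cong)
  have ds_flip: "degree_sign (face xs e) j = - degree_sign xs j"
    if "e \<in> flags xs" "face xs e \<in> I" "fst e < j" "j < k" for e j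
    using sum_sdim_face[OF xs that(1,2,3)] that(4) by (simp add: degree_sign_def)
  have alg: "D * a * (E * b) * r = - (D' * a' * (E' * b') * r)"
    if "(D * E) * (a * b) = - ((D' * E') * (a' * b'))" for D E r a b D' E' a' b' :: real
  proof -
    have "D * a * (E * b) * r = r * ((D * E) * (a * b))" by (simp add: mult_ac)
    also have "\<dots> = - (D' * a' * (E' * b') * r)" by (simp only: that) (simp add: mult_ac)
    finally show ?thesis .
  qed
  show ?thesis
  proof (cases "fst e = fst e'")
    case same: True
    then have "snd e \<noteq> snd e'" using ne by (simp add: prod_eq_iff)
    then have "face_coeff h ori (xs ! fst e) (snd e) * face_coeff h ori (xs ! fst e - {snd e}) (snd e')
        = - (face_coeff h ori (xs ! fst e) (snd e') * face_coeff h ori (xs ! fst e - {snd e'}) (snd e))"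
      using f same simplexD(1) inj_on_simplex by (intro face_coeff_anticommute) auto
    then show ?thesis
      unfolding flag_coeff_def face_face_commute[of xs e' e]
      using f l same by (intro alg) (simp add: ds_same face_nth)
  next
    case False
    then have "face xs e ! fst e' = xs ! fst e'" "face xs e' ! fst e = xs ! fst e"
      using f l by (auto simp: face_nth)
    moreover have "degree_sign xs (fst e) * degree_sign (face xs e) (fst e')
        = - (degree_sign xs (fst e') * degree_sign (face xs e') (fst e))"
      using False f ds_flip[OF e I(1), of "fst e'"] ds_flip[OF e' I(2), of "fst e"]
        ds_same[of "fst e'" e] ds_same[of "fst e" e'] by (cases "fst e < fst e'") auto
    ultimately show ?thesis
      unfolding flag_coeff_def face_face_commute[of xs e' e] by (intro alg) simp
  qed
qed

lemma ext_deriv_ext_deriv: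
  assumes F: "F \<in> supported_on I" shows "d (d F) = (\<lambda>xs. 0)"
proof
  fix xs show "d (d F) xs = 0"
  proof (cases "xs \<in> I")
    case xs: True
    \<comment> \<open>A deleted flag is no longer available, so the sum runs over ordered pairs of
      distinct flags.\<close>
    have "d (d F) xs = (\<Sum>e\<in>flags xs. \<Sum>e'\<in>flags xs - {e}.
        flag_coeff h ori xs e * flag_coeff h ori (face xs e) e' * F (face (face xs e) e'))"
      using ext_deriv_eq[OF ext_deriv_supported xs] ext_deriv_face[OF F xs]
      by (simp add: flags_face sum_distrib_left mult.assoc)
    also have "\<dots> = 0"
      using flag_coeff_antisymmetric[OF F xs] by (rule sum_antisymmetric[OF finite_flags[OF xs]])
    finally show ?thesis .
  qed (simp add: ext_deriv_def)
qed

section \<open>The grading by degree\<close>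

definition degree_part :: "nat \<Rightarrow> 'a set list set" where
  "degree_part p = {xs \<in> I. tuple_degree xs = p}"

lemma degree_part_supported: "F \<in> supported_on (degree_part p) \<Longrightarrow> F \<in> supported_on I"
  by (auto simp: supported_on_def degree_part_def)

lemma ext_deriv_degree:
  assumes F: "F \<in> supported_on (degree_part p)" shows "d F \<in> supported_on (degree_part (Suc p))"
proof -
  have "d F xs = 0" if "xs \<notin> degree_part (Suc p)" for xs
  proof (cases "xs \<in> I")
    case xs: True
    have "F (face xs e) = 0" if e: "e \<in> flags xs" for e
    proof (rule ccontr)
      assume "F (face xs e) \<noteq> 0"
      then have fe: "face xs e \<in> I" "tuple_degree (face xs e) = p"
        using F by (auto simp: supported_on_def degree_part_def)
      have "tuple_degree xs = Suc p"
        using sum_sdim_face[OF xs e fe(1), of k] flagsD[OF xs e] fe(2) interactingD(1)[OF xs]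
        by (simp add: tuple_degree_def)
      then show False using xs \<open>xs \<notin> degree_part (Suc p)\<close> by (simp add: degree_part_def)
    qed
    then show ?thesis using ext_deriv_eq[OF degree_part_supported[OF F] xs] by simp
  qed (simp add: ext_deriv_def)
  then show ?thesis by (simp add: supported_on_def)
qed

end

section \<open>The pullback\<close>

lemma list_sign_map: "list_sign h (map T vs) = list_sign (h \<circ> T) vs"
  by (induction vs) (auto simp: order_sign_def o_def)

lemma vertex_sign_image:
  assumes "inj T" shows "vertex_sign h (T ` x) (T v) = vertex_sign (h \<circ> T) x v"
proof -
  have "T ` x - {T v} = T ` (x - {v})" using assms by (auto simp: inj_def)
  then show ?thesis
    using prod.reindex[of T "x - {v}" "order_sign h (T v)"] inj_on_subset[OF assms]
    by (simp add: vertex_sign_def order_sign_def o_def)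
qed

text \<open>
  Independence of the labelling is what makes the pullback commute with \<open>d\<close>: the automorphism
  turns the labelling \<open>h\<close> into \<open>h \<circ> T\<close>.
\<close>
lemma face_coeff_relabel:
  assumes vs: "distinct (ori x)" "set (ori x) = x" "v \<in> x"
    and ws: "distinct (ori (x - {v}))" "set (ori (x - {v})) = x - {v}"
    and inj: "inj_on h x" "inj_on h' x"
  shows "face_coeff h ori x v = face_coeff h' ori x v"
proof -
  obtain i where i: "i < length (ori x)" "ori x ! i = v" using vs by (metis in_set_conv_nth)
  let ?del = "take i (ori x) @ drop (Suc i) (ori x)"
  \<comment> \<open>The right-hand side consists of a position and an orientation sign, neither of
    which involves the labelling.\<close>
  have "face_coeff h ori x v = (- 1) ^ i * of_int (orient_sign ?del (ori (x - {v})))" if "inj_on h x" for h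
  proof -
    have "of_int (orient_sign ?del (ori (x - {v}))) = list_sign h ?del * list_sign h (ori (x - {v}))"
      using set_delete_nth[OF vs(1) i(1)] ws vs(2) i(2) inj_on_subset[OF that, of "x - {v}"]
      by (intro orient_sign_eq_list_sign) auto
    moreover have "(- 1) ^ i * list_sign h ?del = list_sign h (ori x) * vertex_sign h x v"
      using list_sign_delete[OF i(1) vs(1), of h] that vs(2) i(2) by simp
    ultimately show ?thesis by (simp add: face_coeff_def flip: mult.assoc)
  qed
  then show ?thesis using inj by simp
qed

locale automorphic_complex = oriented_complex +
  fixes T :: "'a \<Rightarrow> 'a"
  assumes automorphism: "automorphism G T"
begin

abbreviation "U \<equiv> pullback G k ori T"

definition simplex_sign :: "'a set \<Rightarrow> real" where
  "simplex_sign x = of_int (orient_sign (ori (T ` x)) (map T (ori x)))"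

lemma inj_T: "inj T"
  using automorphism permutes_inj unfolding automorphism_def by blast

lemma T_simplex: "x \<in> G \<Longrightarrow> T ` x \<in> G"
  using automorphism by (auto simp: automorphism_def bij_betw_def)

lemma pullback_eq: "xs \<in> I \<Longrightarrow> U F xs = (\<Prod>j<k. simplex_sign (xs ! j)) * F (map ((`) T) xs)"
proof -
  assume xs: "xs \<in> I"
  note D = interactingD[OF xs]
  let ?vss = "map (\<lambda>x. map T (ori x)) xs"
  have "map set ?vss = map ((`) T) xs"
    using D oriD by (intro nth_equalityI) auto
  moreover have "(\<Prod>j<length ?vss. real_of_int (orient_sign (ori (set (?vss ! j))) (?vss ! j)))
      = (\<Prod>j<k. simplex_sign (xs ! j))"
    using D oriD by (intro prod.cong) (auto simp: simplex_sign_def)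
  ultimately show ?thesis using xs by (simp only: pullback_def oriented_value_def if_True)
qed

lemma T_interacting: "xs \<in> I \<Longrightarrow> map ((`) T) xs \<in> I"
proof -
  assume xs: "xs \<in> I"
  note D = interactingD[OF xs]
  have "T ` (xs ! i) \<inter> T ` (xs ! j) \<noteq> {}" if "i < k" "j < k" for i j
    using D(3)[OF that] by blast
  then show ?thesis using D T_simplex by (auto simp: interacting_def set_conv_nth)
qed

lemma T_interacting_face:
  assumes xs: "xs \<in> I" and "map ((`) T) (face xs e) \<in> I" shows "face xs e \<in> I"
proof -
  have l: "length (face xs e) = k" using interactingD(1)[OF xs] by simp
  have meet: "face xs e ! i \<inter> face xs e ! j \<noteq> {}" if "i < k" "j < k" for i j
  proof -
    have "T ` (face xs e ! i) \<inter> T ` (face xs e ! j) \<noteq> {}"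
      using interactingD(3)[OF assms(2) that] that l by simp
    then show ?thesis using inj_T by (auto simp: inj_def)
  qed
  have "face xs e ! i \<in> G" if "i < k" for i
    using face_subsimplex[OF xs that, of e] meet[OF that that] simplexD(3) by blast
  then show ?thesis using l meet by (auto simp: interacting_def set_conv_nth)
qed

lemma sdim_image: "sdim (T ` x) = sdim x"
  using card_image[of T x] inj_on_subset[OF inj_T] by (simp add: sdim_def)

text \<open>This says, one coefficient at a time, that \<open>T\<close> commutes with the boundary
  of a single simplex.\<close>

lemma simplex_sign_face_coeff:
  assumes x: "x \<in> G" and v: "v \<in> x" and y: "x - {v} \<in> G"
  shows "simplex_sign x * face_coeff h ori (T ` x) (T v) = face_coeff h ori x v * simplex_sign (x - {v})"
proof -
  have inj_hT: "inj_on (h \<circ> T) x"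
    using inj_on_simplex[OF T_simplex[OF x]] inj_on_subset[OF inj_T] by (intro comp_inj_on) auto
  have \<tau>: "simplex_sign z = list_sign h (ori (T ` z)) * list_sign (h \<circ> T) (ori z)" if "z \<in> G" for z
    unfolding simplex_sign_def list_sign_map[symmetric]
    using oriD[OF that] oriD[OF T_simplex[OF that]] inj_on_simplex[OF T_simplex[OF that]] inj_on_subset[OF inj_T]
    by (intro orient_sign_eq_list_sign) (auto simp: distinct_map)
  have TD: "T ` x - {T v} = T ` (x - {v})" using inj_T by (auto simp: inj_def)
  \<comment> \<open>In the labelling \<open>h \<circ> T\<close> the list sign of
    \<open>ori (x - {v})\<close> also occurs in \<open>simplex_sign (x - {v})\<close>, so the two
    cancel.\<close>
  have "face_coeff h ori x v = face_coeff (h \<circ> T) ori x v"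
    using oriD x y v inj_on_simplex[OF x] inj_hT by (intro face_coeff_relabel) auto
  then have "face_coeff h ori x v * simplex_sign (x - {v})
      = list_sign (h \<circ> T) (ori x) * vertex_sign (h \<circ> T) x v * list_sign h (ori (T ` (x - {v})))"
    by (simp add: \<tau>[OF y] face_coeff_def list_sign_square mult_ac)
  also have "\<dots> = simplex_sign x * face_coeff h ori (T ` x) (T v)"
    by (simp add: \<tau>[OF x] face_coeff_def TD vertex_sign_image[OF inj_T] list_sign_square mult_ac)
  finally show ?thesis ..
qed

lemma flags_image: "length xs = k \<Longrightarrow> flags (map ((`) T) xs) = map_prod id T ` flags xs"
  by (auto simp: flags_def image_iff)

lemma face_image: "fst e < length xs \<Longrightarrow> face (map ((`) T) xs) (map_prod id T e) = map ((`) T) (face xs e)"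
  using inj_T by (intro nth_equalityI) (auto simp: face_nth inj_def)

lemma simplex_sign_flag_coeff:
  assumes xs: "xs \<in> I" and e: "e \<in> flags xs" and fe: "face xs e \<in> I"
  shows "(\<Prod>j<k. simplex_sign (xs ! j)) * flag_coeff h ori (map ((`) T) xs) (map_prod id T e)
    = flag_coeff h ori xs e * (\<Prod>j<k. simplex_sign (face xs e ! j))"
proof -
  note D = interactingD[OF xs]
  have f: "fst e < k" "snd e \<in> xs ! fst e" "xs ! fst e \<in> G" using flagsD[OF xs e] by auto
  have ds: "degree_sign (map ((`) T) xs) (fst e) = degree_sign xs (fst e)"
    using f D by (auto simp: degree_sign_def sdim_image intro!: arg_cong[where f = "\<lambda>n. (- 1) ^ n"] sum.cong)
  have y: "face xs e ! fst e = xs ! fst e - {snd e}" using f D by (simp add: face_nth)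
  then have "xs ! fst e - {snd e} \<in> G" using interactingD(2)[OF fe f(1)] by simp
  note c = simplex_sign_face_coeff[OF f(3,2) this]
  have "(\<Prod>j<k. simplex_sign (xs ! j)) = simplex_sign (xs ! fst e) * (\<Prod>j\<in>{..<k} - {fst e}. simplex_sign (xs ! j))"
    using f by (intro prod.remove) auto
  moreover have "(\<Prod>j<k. simplex_sign (face xs e ! j))
      = simplex_sign (face xs e ! fst e) * (\<Prod>j\<in>{..<k} - {fst e}. simplex_sign (face xs e ! j))"
    using f by (intro prod.remove) auto
  moreover have "(\<Prod>j\<in>{..<k} - {fst e}. simplex_sign (face xs e ! j)) = (\<Prod>j\<in>{..<k} - {fst e}. simplex_sign (xs ! j))"
    using D by (intro prod.cong) (auto simp: face_nth)
  ultimately show ?thesis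
    using c f D by (simp add: flag_coeff_def ds y mult_ac)
qed

text \<open>\<open>T\<close> carries the flags of \<open>xs\<close> bijectively to those of the
  image tuple; after reindexing, the two sums agree term by term.\<close>

lemma pullback_ext_deriv:
  assumes F: "F \<in> supported_on I" shows "U (d F) = d (U F)"
proof
  fix xs show "U (d F) xs = d (U F) xs"
  proof (cases "xs \<in> I")
    case xs: True
    note D = interactingD[OF xs]
    have sup: "U F \<in> supported_on I" by (simp add: supported_on_def pullback_def)
    have "U (d F) xs = (\<Prod>j<k. simplex_sign (xs ! j)) *
        (\<Sum>e\<in>flags (map ((`) T) xs). flag_coeff h ori (map ((`) T) xs) e * F (face (map ((`) T) xs) e))"
      using pullback_eq[OF xs, of "d F"] ext_deriv_eq[OF F T_interacting[OF xs]] by simp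
    also have "\<dots> = (\<Sum>e\<in>flags xs. (\<Prod>j<k. simplex_sign (xs ! j)) *
        (flag_coeff h ori (map ((`) T) xs) (map_prod id T e) * F (face (map ((`) T) xs) (map_prod id T e))))"
    proof -
      have "inj_on (map_prod id T) (flags xs)"
        using prod.inj_map[OF inj_on_id inj_T] by (rule inj_on_subset) simp
      then show ?thesis
        unfolding flags_image[OF D(1)] by (subst sum.reindex) (simp_all add: sum_distrib_left)
    qed
    also have "\<dots> = (\<Sum>e\<in>flags xs. flag_coeff h ori xs e * U F (face xs e))"
    proof (intro sum.cong refl)
      fix e assume e: "e \<in> flags xs"
      have im: "face (map ((`) T) xs) (map_prod id T e) = map ((`) T) (face xs e)"
        using flagsD[OF xs e] D(1) by (intro face_image) simp
      show "(\<Prod>j<k. simplex_sign (xs ! j)) *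
          (flag_coeff h ori (map ((`) T) xs) (map_prod id T e) * F (face (map ((`) T) xs) (map_prod id T e)))
          = flag_coeff h ori xs e * U F (face xs e)"
      proof (cases "face xs e \<in> I")
        case True
        then show ?thesis
          using simplex_sign_flag_coeff[OF xs e True] by (simp add: im pullback_eq flip: mult.assoc)
      next
        case False
        \<comment> \<open>An injective \<open>T\<close> also reflects interaction, so both sides
          vanish at such a face.\<close>
        then have "F (map ((`) T) (face xs e)) = 0"
          using T_interacting_face[OF xs, of e] F by (auto simp: supported_on_def)
        then show ?thesis using False sup by (simp add: im supported_on_def)
      qed
    qed
    also have "\<dots> = d (U F) xs" using ext_deriv_eq[OF sup xs] by simp
    finally show ?thesis .
  qed (simp add: ext_deriv_def pullback_def)
qed

section \<open>The pullback in each degree and its diagonal entries\<close>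

lemma tuple_degree_image: "tuple_degree (map ((`) T) xs) = tuple_degree xs"
  by (simp add: tuple_degree_def sdim_image)

lemma pullback_degree:
  assumes "F \<in> supported_on (degree_part p)" shows "U F \<in> supported_on (degree_part p)"
proof -
  have "U F xs = 0" if "xs \<notin> degree_part p" for xs
  proof (cases "xs \<in> I")
    case True
    then have "map ((`) T) xs \<notin> degree_part p"
      using that by (simp add: degree_part_def tuple_degree_image)
    then show ?thesis using assms True by (simp add: pullback_eq supported_on_def)
  qed (simp add: pullback_def)
  then show ?thesis by (simp add: supported_on_def)
qed

text \<open>\<open>orient_sign\<close> refers to a permutation that is the identity off the simplex;
  on a fixed simplex this is \<open>T\<close> restricted to it, not \<open>T\<close> itself.\<close>

lemma simplex_sign_fixed:
  assumes x: "x \<in> G" and fixed: "T ` x = x" shows "simplex_sign x = of_int (sign (perm_restrict T x))"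
proof -
  have "bij_betw (perm_restrict T x) x x"
    using fixed inj_on_subset[OF inj_T, of x]
    by (auto simp: bij_betw_def inj_on_def perm_restrict_def image_def)
  then have "perm_restrict T x permutes x"
    by (intro bij_imp_permutes) (auto simp: perm_restrict_def)
  moreover have "map (perm_restrict T x) (ori x) = map T (ori x)"
    using oriD[OF x] by (simp add: perm_restrict_def)
  ultimately show ?thesis
    using fixed oriD[OF x] by (simp add: simplex_sign_def orient_sign_permutes)
qed

text \<open>\<open>U\<close> evaluates the point function at the image tuple, so the diagonal entry
  is nonzero only if \<open>T\<close> fixes each entry; the degree sign then distributes over the
  entries.\<close>

lemma pullback_diagonal:
  assumes xs: "xs \<in> I"
  shows "(- 1) ^ tuple_degree xs * U (point_fun xs) xs
    = (if xs \<in> fixed_tuples G k T then tuple_index k T xs else 0)"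
proof -
  note D = interactingD[OF xs]
  have iff: "map ((`) T) xs = xs \<longleftrightarrow> xs \<in> fixed_tuples G k T"
    using xs D(1) by (auto simp: fixed_tuples_def list_eq_iff_nth_eq)
  show ?thesis
  proof (cases "xs \<in> fixed_tuples G k T")
    case True
    then have "simplex_sign (xs ! j) = of_int (sign (perm_restrict T (xs ! j)))" if "j < k" for j
      using D(2) that by (intro simplex_sign_fixed) (auto simp: fixed_tuples_def)
    moreover have "(- 1 :: real) ^ tuple_degree xs = (\<Prod>j<k. (- 1) ^ sdim (xs ! j))"
      using D(1) by (simp add: tuple_degree_def power_sum)
    ultimately show ?thesis
      using True iff by (simp add: pullback_eq[OF xs] point_fun_def tuple_index_def prod.distrib)
  next
    case False
    then show ?thesis using iff by (simp add: pullback_eq[OF xs] point_fun_def)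
  qed
qed

theorem lefschetz_number_eq:
  "lefschetz_number G k ori T = (\<Sum>xs\<in>fixed_tuples G k T. tuple_index k T xs)"
proof -
  define Z where "Z p = {F \<in> supported_on (degree_part p). d F = (\<lambda>xs. 0)}" for p
  have cocycles: "cocycles G k ori p = fun_module (Z p)" for p
    by (auto simp: cocycles_def forms_def fun_module_def Z_def supported_on_def degree_part_def)
  have coboundaries: "coboundaries G k ori (Suc p) = d ` supported_on (degree_part p)" for p
    by (auto simp: forms_def supported_on_def degree_part_def)
  have fin: "finite (degree_part p)" for p
    using finite_interacting by (simp add: degree_part_def)
  \<comment> \<open>There are finitely many interacting tuples, so their degrees are bounded and the
    complex vanishes from degree \<open>N\<close> on.\<close>
  obtain N where N: "\<And>xs. xs \<in> I \<Longrightarrow> tuple_degree xs < N"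
    using finite_nat_set_iff_bounded[of "tuple_degree ` I"] finite_interacting by auto
  have "lefschetz_number G k ori T = (\<Sum>p<N. (- 1) ^ p * fun_trace (degree_part p) U)"
    unfolding lefschetz_number_def cohomology_def cohomology_map_def cocycles
  proof (rule hopf_trace)
    show "degree_part p = {}" if "p \<ge> N" for p using N that by (auto simp: degree_part_def not_less[symmetric])
    show "d (d F) = (\<lambda>xs. 0)" if "F \<in> supported_on (degree_part p)" for p F
      using ext_deriv_ext_deriv[OF degree_part_supported[OF that]] .
    show "U (d F) = d (U F)" if "F \<in> supported_on (degree_part p)" for p F
      using pullback_ext_deriv[OF degree_part_supported[OF that]] .
  qed (use fin fun_linear_ext_deriv fun_linear_pullback ext_deriv_degree pullback_degree coboundaries in
      \<open>simp_all only: Z_def coboundaries.simps(1)\<close>)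
  also have "\<dots> = (\<Sum>p<N. \<Sum>xs\<in>degree_part p. (- 1) ^ tuple_degree xs * U (point_fun xs) xs)"
    by (simp add: fun_trace_def sum_distrib_left degree_part_def)
  \<comment> \<open>The degree parts below \<open>N\<close> partition the interacting
    tuples.\<close>
  also have "\<dots> = (\<Sum>xs\<in>I. (- 1) ^ tuple_degree xs * U (point_fun xs) xs)"
    unfolding degree_part_def using N finite_interacting
    by (intro sum.group) auto
  also have "\<dots> = (\<Sum>xs\<in>I. if xs \<in> fixed_tuples G k T then tuple_index k T xs else 0)"
    by (intro sum.cong) (auto simp: pullback_diagonal)
  also have "\<dots> = (\<Sum>xs\<in>fixed_tuples G k T. tuple_index k T xs)"
    using finite_interacting
    by (intro sum.mono_neutral_cong_right) (auto simp: fixed_tuples_def)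
  finally show ?thesis .
qed

end

theorem mainTheorem5:
  fixes G :: "'a set set" and k :: nat and ori :: "'a set \<Rightarrow> 'a list" and T :: "'a \<Rightarrow> 'a"
  assumes "simplicial_complex G"
    and "orientation G ori"
    and "k \<ge> 1"
    and "automorphism G T"
  shows "lefschetz_number G k ori T = (\<Sum>xs\<in>fixed_tuples G k T. tuple_index k T xs)"
proof -
  have "finite (\<Union>G)" using assms(1) by (auto simp: simplicial_complex_def)
  \<comment> \<open>Finitely many vertices can be labelled injectively by naturals; neither side of
    the conclusion depends on the choice.\<close>
  then obtain h :: "'a \<Rightarrow> nat" where "inj_on h (\<Union>G)"
    using finite_imp_inj_to_nat_seg by blast
  then interpret automorphic_complex G k ori h T
    by unfold_locales (use assms in auto)
  show ?thesis by (rule lefschetz_number_eq)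
qed

end
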